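(* Let $q$ be a power of a prime, let $m > 1$, let $Q = (q^m-1)/(q-1)$, and let $N \mid q^m-1$ be such that $L_Q \mid N$, where $L_Q$ is the largest divisor of $q^m-1$ with the same radical as that of $Q$. Then there exists an element $\xi \in \mathbb{F}_{q^m}^*$ of multiplicative order $N$ satisfying $\operatorname{Tr}_{\mathbb{F}_{q^m}/\mathbb{F}_q}(\xi) = 0$ if and only if $m \neq 2$ and $(q,m) \neq (4,3)$.
   Context: The radical of a positive integer $n$ is the product of all distinct prime factors of $n$ (the radical of $1$ is $1$). *)

theory Defs
  imports
    "HOL-Algebra.Multiplicative_Group"
    "HOL-Algebra.Embedded_Algebras"
    "HOL-Number_Theory.Prime_Powers"
begin

definition nat_radical :: "nat \<Rightarrow> nat" where
  "nat_radical n = \<Prod>(prime_factors n)"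

(* For n > 0 this is a maximum over a finite set; the set is nonempty when a divides n. *)
definition largest_divisor_same_radical :: "nat \<Rightarrow> nat \<Rightarrow> nat" where
  "largest_divisor_same_radical n a = Max {d. d dvd n \<and> nat_radical d = nat_radical a}"

(* Tr_{F/K}(x) = x + x^q + ... + x^(q^(m-1)) for an extension F/K of finite fields, where
   q = |K| and m = [F:K]. The constant ring.dim takes its arguments in the order
   ring, field of scalars, vector space. *)
definition finite_field_trace :: "('a, 'b) ring_scheme \<Rightarrow> 'a set \<Rightarrow> 'a \<Rightarrow> 'a" where
  "finite_field_trace F K x =
     (\<Oplus>\<^bsub>F\<^esub>i\<in>{..<ring.dim F K (carrier F)}. x [^]\<^bsub>F\<^esub> (card K ^ i))"

end

theory Submission
  imports Defs "HOL-Number_Theory.Residues"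
begin

text \<open>
  Write \<open>F\<^sup>*\<close> as the powers of a generator \<open>g\<close> and let \<open>Q = (q^m - 1) / (q - 1)\<close>. The exponents
  divisible by \<open>Q\<close> are those of the nonzero scalars from \<open>K\<close>, and the trace is \<open>K\<close>-linear; so whether
  \<open>g^j\<close> has trace zero depends only on \<open>j mod Q\<close>. Let \<open>D\<close> be the set of residues \<open>i < Q\<close> for which
  \<open>g^i\<close> has trace zero. The order condition behaves in the same way. The number \<open>L\<^sub>Q\<close> collects the full
  \<open>p\<close>-parts of \<open>q^m - 1\<close> for all primes \<open>p\<close> dividing \<open>Q\<close>, so if an exponent is coprime to \<open>Q\<close>, it can be
  moved by a multiple of \<open>Q\<close> until the element has order exactly \<open>N\<close>, whatever multiple \<open>N\<close> of \<open>L\<^sub>Q\<close>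
  is prescribed (\<open>exists_order_of_coprime\<close>). What has to be found is an element of \<open>D\<close> coprime
  to \<open>Q\<close>.

  Since \<open>D\<close> is the image of a hyperplane, it is a Singer difference set (\<open>difference_set\<close>): its shift
  by any \<open>t \<noteq> 0\<close> modulo \<open>Q\<close> meets it in the same number of points, because two independent linear
  conditions always cut out a subspace of codimension two. Consequently every nontrivial character sum
  over \<open>D\<close> has absolute value exactly \<open>\<surd>(q^(m-2))\<close> (\<open>norm_character_sum\<close>), and inclusion-exclusion
  turns this into a sieve (\<open>card_coprime_ge\<close>, \<open>sieve_criterion\<close>): \<open>D\<close>, whose size is about
  \<open>q^(m-2)\<close>, contains a unit modulo \<open>Q\<close> as soon as \<open>Q\<close> has few prime divisors. Let \<open>w\<close> be their number.
  For \<open>m \<ge> 5\<close> always \<open>4^w \<le> q^(m-2)\<close>, and that suffices. For \<open>m = 4\<close> the condition \<open>2^w \<le> q + 2\<close> suffices,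
  and it fails only for \<open>q = 5\<close> and \<open>q = 13\<close>. For \<open>m = 3\<close> all prime divisors of \<open>q\<^sup>2 + q + 1\<close> are \<open>3\<close> or
  congruent to \<open>1\<close> modulo \<open>3\<close>. If \<open>w \<ge> 8\<close>, this makes \<open>q\<close> so large that \<open>4^w \<le> q\<close>; if \<open>w \<le> 7\<close>, the sum of their
  reciprocals is so small that a plain union bound works, apart from \<open>q = 4\<close> and \<open>q = 16\<close>.

  The remaining pairs \<open>(q, m)\<close> are \<open>(16, 3)\<close>, \<open>(5, 4)\<close> and \<open>(13, 4)\<close>. In the first two, \<open>D\<close> is mapped to itself
  by multiplication with the characteristic \<open>p \<equiv> 2\<close> modulo \<open>3\<close>, which forces the cubic character sum to
  be real and so determines the number of multiples of \<open>3\<close> in \<open>D\<close> exactly (\<open>residue_counts_mod_3\<close>). In the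
  last one the small primes \<open>2, 5, 7\<close> are sieved out together and \<open>17\<close> separately.

  The exceptions are genuine. For \<open>m = 2\<close> an element of trace zero satisfies \<open>x^(q-1) = -1\<close>, so its order
  is too small. For \<open>(q, m) = (4, 3)\<close> the cube \<open>y\<close> of such an element is a root of
  \<open>y^5 + y + 1 = (y\<^sup>2 + y + 1) (y^3 + y\<^sup>2 + 1)\<close>, so the order of \<open>y\<close> is \<open>3\<close> or \<open>7\<close>, while the
  prescribed order \<open>63\<close> would give \<open>21\<close>.
\<close>

section \<open>Character sums and sieving in a cyclic difference set\<close>

locale cyclic_difference_set =
  fixes Q lam n :: nat and D :: "nat set"
  assumes D_subset: "D \<subseteq> {..<Q}"
    and card_D: "card D = lam + n"
    and card_shift: "\<And>t. 0 < t \<Longrightarrow> t < Q \<Longrightarrow> card {i\<in>D. (i + t) mod Q \<in> D} = lam"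
begin

lemma finite_D: "finite D"
  using D_subset finite_subset by blast

text \<open>Expanding the square of the absolute value groups pairs of elements of \<open>D\<close> by their difference \<open>t\<close>.
Every \<open>t \<noteq> 0\<close> occurs \<open>lam\<close> times and \<open>t = 0\<close> occurs \<open>lam + n\<close> times, and the full geometric sum of
the powers of \<open>w\<close> vanishes, so only the surplus \<open>n\<close> at \<open>t = 0\<close> survives.\<close>
lemma norm_character_sum:
  fixes w :: complex
  assumes "w ^ Q = 1" "w \<noteq> 1"
  shows "norm (\<Sum>i\<in>D. w ^ i) = sqrt (real n)"
proof (cases "Q = 0")
  case True
  then have "D = {}" using D_subset by auto
  then show ?thesis using card_D by simp
next
  case False
  then have Q: "Q > 0" by simp
  have "norm w ^ Q = 1" using assms(1) by (metis norm_one norm_power)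
  then have nw: "norm w = 1" using Q
    by (metis norm_ge_zero power_eq_imp_eq_base power_one zero_le_one)
  have wcnj: "w ^ j * cnj (w ^ j) = 1" for j
    using complex_norm_square[of "w ^ j"] by (simp add: norm_power nw)
  have wmod: "w ^ (a mod Q) = w ^ a" for a
  proof -
    have "w ^ a = w ^ (Q * (a div Q) + a mod Q)" by simp
    also have "\<dots> = w ^ (a mod Q)" unfolding power_add power_mult assms(1) by simp
    finally show ?thesis by simp
  qed
  define a where "a = (\<lambda>i. if i \<in> D then 1 else 0 :: complex)"
  have sumD: "(\<Sum>i\<in>D. f i) = (\<Sum>i<Q. a i * f i)" for f :: "nat \<Rightarrow> complex"
    using D_subset by (simp add: a_def if_distrib[of "\<lambda>x. x * _"] sum.If_cases Int_absorb1 cong: if_cong)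
  have inner: "(\<Sum>i\<in>D. w ^ i) * cnj (w ^ j) = (\<Sum>t<Q. a ((j + t) mod Q) * w ^ t)" if j: "j < Q" for j
  proof -
    have bij: "bij_betw (\<lambda>t. (j + t) mod Q) {..<Q} {..<Q}"
    proof (rule bij_betwI[where g = "\<lambda>s. (s + (Q - j)) mod Q"])
      show "(\<lambda>t. (j + t) mod Q) \<in> {..<Q} \<rightarrow> {..<Q}" "(\<lambda>s. (s + (Q - j)) mod Q) \<in> {..<Q} \<rightarrow> {..<Q}"
        using Q by auto
      fix t assume "t \<in> {..<Q}"
      have "((j + t) mod Q + (Q - j)) mod Q = (j + t + (Q - j)) mod Q" by (simp add: mod_simps)
      also have "j + t + (Q - j) = t + Q" using j by simp
      finally show "((j + t) mod Q + (Q - j)) mod Q = t" using \<open>t \<in> _\<close> by simp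
    next
      fix s assume "s \<in> {..<Q}"
      have "(j + (s + (Q - j)) mod Q) mod Q = (j + (s + (Q - j))) mod Q" by (simp add: mod_simps)
      also have "j + (s + (Q - j)) = s + Q" using j by simp
      finally show "(j + (s + (Q - j)) mod Q) mod Q = s" using \<open>s \<in> _\<close> by simp
    qed
    have "(\<Sum>i\<in>D. w ^ i) * cnj (w ^ j) = (\<Sum>i<Q. a i * w ^ i) * cnj (w ^ j)" by (simp add: sumD)
    also have "(\<Sum>i<Q. a i * w ^ i) = (\<Sum>t<Q. a ((j + t) mod Q) * w ^ ((j + t) mod Q))"
      by (rule sum.reindex_bij_betw[OF bij, symmetric])
    also have "\<dots> * cnj (w ^ j) = (\<Sum>t<Q. a ((j + t) mod Q) * w ^ t * (w ^ j * cnj (w ^ j)))"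
      unfolding sum_distrib_right wmod power_add by (intro sum.cong) (simp_all only: mult_ac)
    finally show ?thesis by (simp add: wcnj del: complex_cnj_power)
  qed
  have cnt: "(\<Sum>j\<in>D. a ((j + t) mod Q)) = of_nat lam + (if t = 0 then of_nat n else 0)" if "t < Q" for t
  proof -
    have "(\<Sum>j\<in>D. a ((j + t) mod Q)) = of_nat (card {j\<in>D. (j + t) mod Q \<in> D})"
      using finite_D by (simp add: a_def sum.If_cases Int_def)
    moreover have "{j\<in>D. j mod Q \<in> D} = D" using D_subset by auto
    ultimately show ?thesis using card_shift[of t] that card_D by (cases "t = 0") auto
  qed
  have geo: "(\<Sum>t<Q. w ^ t) = 0"
    using assms by (simp add: sum_gp_strict)
  have "of_real (norm (\<Sum>i\<in>D. w ^ i) ^ 2) = (\<Sum>i\<in>D. w ^ i) * cnj (\<Sum>i\<in>D. w ^ i)"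
    by (rule complex_norm_square)
  also have "\<dots> = (\<Sum>j\<in>D. (\<Sum>i\<in>D. w ^ i) * cnj (w ^ j))"
    by (simp only: cnj_sum sum_distrib_left)
  also have "\<dots> = (\<Sum>j\<in>D. \<Sum>t<Q. a ((j + t) mod Q) * w ^ t)"
    using inner D_subset by (intro sum.cong) auto
  also have "\<dots> = (\<Sum>t<Q. (\<Sum>j\<in>D. a ((j + t) mod Q)) * w ^ t)"
    unfolding sum_distrib_right by (rule sum.swap)
  also have "\<dots> = (\<Sum>t<Q. of_nat lam * w ^ t + (if t = 0 then of_nat n else 0))"
    by (intro sum.cong refl, subst cnt) (auto simp: distrib_right)
  also have "\<dots> = of_real (real n)"
    using Q geo by (simp add: sum.distrib sum_distrib_left[symmetric])
  finally have "norm (\<Sum>i\<in>D. w ^ i) ^ 2 = real n"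
    using of_real_eq_iff by blast
  then show ?thesis by (metis norm_ge_zero real_sqrt_unique)
qed

end

definition prime_root :: "nat \<Rightarrow> complex" where
  "prime_root l = cis (2 * pi / real l)"

lemma prime_root_power_eq_1_iff:
  assumes "l > 0"
  shows "prime_root l ^ j = 1 \<longleftrightarrow> l dvd j"
proof
  assume "prime_root l ^ j = 1"
  then have "cos (real j * (2 * pi / real l)) = 1"
    unfolding prime_root_def Complex.DeMoivre by (metis cis.sel(1) one_complex.sel(1))
  then obtain x :: int where "real j * (2 * pi / real l) = of_int x * 2 * pi"
    using cos_one_2pi_int by auto
  then have "real j = of_int x * real l" using assms by (simp add: field_simps)
  then have "int j = x * int l" by (metis of_int_eq_iff of_int_mult of_int_of_nat_eq)
  then show "l dvd j" by (metis dvd_triv_right int_dvd_int_iff)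
next
  assume "l dvd j"
  then obtain c where "j = l * c" ..
  moreover have "prime_root l ^ l = 1" using assms by (simp add: prime_root_def Complex.DeMoivre)
  ultimately show "prime_root l ^ j = 1" by (simp add: power_mult)
qed

text \<open>Orthogonality of the characters modulo \<open>l\<close>, with the trivial character moved to the left-hand side:
the centred indicator of the multiples of \<open>l\<close> involves nontrivial characters only.\<close>
lemma indicator_dvd_conv_sum_roots:
  assumes "l > (0::nat)"
  shows "of_bool (l dvd i) - 1 / of_nat l = (\<Sum>j\<in>{1..<l}. (prime_root l ^ j) ^ i / of_nat l)"
proof -
  have "(\<Sum>j<l. (prime_root l ^ i) ^ j) = (if l dvd i then of_nat l else 0)"
  proof (cases "l dvd i")
    case True then show ?thesis using prime_root_power_eq_1_iff[OF assms, of i] by simp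
  next
    case False
    then have "prime_root l ^ i \<noteq> 1" using prime_root_power_eq_1_iff[OF assms, of i] by simp
    moreover have "(prime_root l ^ i) ^ l = 1"
      unfolding power_mult[symmetric] by (subst prime_root_power_eq_1_iff[OF assms]) simp
    ultimately show ?thesis using False by (simp add: sum_gp_strict)
  qed
  moreover have "{..<l} = insert 0 {1..<l}" using assms by auto
  ultimately have "1 + (\<Sum>j\<in>{1..<l}. (prime_root l ^ i) ^ j) = (if l dvd i then of_nat l else 0)"
    by simp
  then have "(\<Sum>j\<in>{1..<l}. (prime_root l ^ j) ^ i) = (if l dvd i then of_nat l else 0) - 1"
    by (simp add: power_mult[symmetric] mult.commute eq_diff_eq add.commute)
  then show ?thesis using assms by (simp add: sum_divide_distrib[symmetric] diff_divide_distrib)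
qed

context cyclic_difference_set
begin

text \<open>A product of centred indicators for distinct primes expands into \<open>\<Prod>(l - 1)\<close> characters modulo \<open>Q\<close>
with coefficients \<open>\<Prod>(1 / l)\<close>, one for each choice of nontrivial characters modulo the primes in \<open>T\<close>.
All of them are nontrivial because the primes are distinct, so each contributes at most \<open>\<surd>n\<close>.\<close>
lemma abs_sum_prod_indicator_le:
  assumes fin: "finite T" and "T \<noteq> {}" and T: "\<And>l. l \<in> T \<Longrightarrow> prime l \<and> l dvd Q"
  shows "\<bar>\<Sum>i\<in>D. \<Prod>l\<in>T. of_bool (l dvd i) - 1 / real l\<bar> \<le> sqrt (real n) * (\<Prod>l\<in>T. 1 - 1 / real l)"
proof -
  define G where "G = PiE T (\<lambda>l. {1..<l})"
  define w where "w = (\<lambda>g. \<Prod>l\<in>T. prime_root l ^ g l)"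
  define c where "c = (\<Prod>l\<in>T. 1 / of_nat l :: complex)"
  have pos: "l > 0" if "l \<in> T" for l using T[OF that] prime_gt_0_nat by blast
  have expand: "(\<Prod>l\<in>T. of_bool (l dvd i) - 1 / of_nat l) = c * (\<Sum>g\<in>G. w g ^ i)" for i
  proof -
    have "(\<Prod>l\<in>T. of_bool (l dvd i) - 1 / of_nat l :: complex)
        = (\<Prod>l\<in>T. \<Sum>j\<in>{1..<l}. (prime_root l ^ j) ^ i / of_nat l)"
      by (intro prod.cong refl indicator_dvd_conv_sum_roots pos)
    also have "\<dots> = (\<Sum>g\<in>G. \<Prod>l\<in>T. (prime_root l ^ g l) ^ i / of_nat l)"
      unfolding G_def by (rule prod_sum_PiE) (use fin in auto)
    also have "\<dots> = c * (\<Sum>g\<in>G. w g ^ i)"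
      by (simp add: sum_distrib_left c_def w_def prod_dividef prod_power_distrib)
    finally show ?thesis .
  qed
  have wQ: "w g ^ Q = 1" for g
  proof -
    have "(prime_root l ^ g l) ^ Q = 1" if "l \<in> T" for l
      unfolding power_mult[symmetric] using T[OF that] pos[OF that] by (simp add: prime_root_power_eq_1_iff)
    then show ?thesis by (simp add: w_def prod_power_distrib)
  qed
  have w1: "w g \<noteq> 1" if "g \<in> G" for g
  proof
    assume w: "w g = 1"
    obtain l where l: "l \<in> T" using assms(2) by blast
    define P where "P = \<Prod>(T - {l})"
    have 1: "(prime_root l' ^ g l') ^ P = 1" if "l' \<in> T - {l}" for l'
    proof -
      have "l' dvd P" unfolding P_def using that fin dvd_prodI[of "T - {l}" l' "\<lambda>x. x"] by simp
      then show ?thesis unfolding power_mult[symmetric]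
        using pos[of l'] that by (simp add: prime_root_power_eq_1_iff)
    qed
    \<comment> \<open>raising to the power \<open>P\<close> kills the components at all primes other than \<open>l\<close>\<close>
    have "1 = w g ^ P" using w by simp
    also have "\<dots> = (prime_root l ^ g l) ^ P * (\<Prod>l'\<in>T - {l}. (prime_root l' ^ g l') ^ P)"
      using fin l by (simp add: w_def prod.remove power_mult_distrib prod_power_distrib)
    also have "\<dots> = prime_root l ^ (g l * P)" using 1 by (simp add: power_mult)
    finally have "l dvd g l * P" using prime_root_power_eq_1_iff[OF pos[OF l]] by metis
    moreover have "\<not> l dvd g l" using \<open>g \<in> G\<close> l by (auto simp: G_def PiE_def Pi_def dest!: nat_dvd_not_less[rotated])
    moreover have "\<not> l dvd P"
    proof
      assume "l dvd P"
      then obtain l' where "l' \<in> T - {l}" "l dvd l'"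
        unfolding P_def using T[OF l] fin prime_dvd_prod_iff[of "T - {l}" l "\<lambda>x. x"] by auto
      then show False using T l primes_dvd_imp_eq[of l l'] by auto
    qed
    ultimately show False using T[OF l] prime_dvd_mult_iff by blast
  qed
  have of_real_ind: "complex_of_real (of_bool b) = of_bool b" for b by (cases b) auto
  have "complex_of_real (\<Sum>i\<in>D. \<Prod>l\<in>T. of_bool (l dvd i) - 1 / real l)
      = (\<Sum>i\<in>D. \<Prod>l\<in>T. of_bool (l dvd i) - 1 / of_nat l)" by (simp add: of_real_ind)
  also have "\<dots> = c * (\<Sum>g\<in>G. \<Sum>i\<in>D. w g ^ i)"
    unfolding expand sum_distrib_left[symmetric] by (subst sum.swap) simp
  finally have "norm (complex_of_real (\<Sum>i\<in>D. \<Prod>l\<in>T. of_bool (l dvd i) - 1 / real l))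
      = norm c * norm (\<Sum>g\<in>G. \<Sum>i\<in>D. w g ^ i)" by (simp only: norm_mult)
  then have "\<bar>\<Sum>i\<in>D. \<Prod>l\<in>T. of_bool (l dvd i) - 1 / real l\<bar> = norm c * norm (\<Sum>g\<in>G. \<Sum>i\<in>D. w g ^ i)"
    by (simp only: norm_of_real)
  also have "\<dots> \<le> norm c * (\<Sum>g\<in>G. norm (\<Sum>i\<in>D. w g ^ i))"
    by (intro mult_left_mono norm_sum) auto
  also have "\<dots> = norm c * (real (card G) * sqrt (real n))"
    using norm_character_sum[OF wQ w1] by simp
  also have "norm c = (\<Prod>l\<in>T. 1 / real l)"
    by (simp add: c_def norm_divide prod_norm[symmetric])
  also have "real (card G) = (\<Prod>l\<in>T. real (l - 1))"
    unfolding G_def by (simp add: card_PiE fin)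
  also have "(\<Prod>l\<in>T. 1 / real l) * ((\<Prod>l\<in>T. real (l - 1)) * sqrt (real n))
      = sqrt (real n) * (\<Prod>l\<in>T. 1 / real l * real (l - 1))"
    by (simp only: prod.distrib mult_ac)
  also have "(\<Prod>l\<in>T. 1 / real l * real (l - 1)) = (\<Prod>l\<in>T. 1 - 1 / real l)"
    by (intro prod.cong) (auto simp: field_simps of_nat_diff Suc_leI dest!: pos)
  finally show ?thesis .
qed

lemma card_multiples_le:
  assumes "prime l" "l dvd Q"
  shows "real (card {i\<in>D. l dvd i}) \<le> real (card D) / real l + (1 - 1 / real l) * sqrt (real n)"
proof -
  have "\<bar>\<Sum>i\<in>D. of_bool (l dvd i) - 1 / real l\<bar> \<le> sqrt (real n) * (1 - 1 / real l)"
    using abs_sum_prod_indicator_le[of "{l}"] assms by simp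
  moreover have "(\<Sum>i\<in>D. of_bool (l dvd i) - 1 / real l) = real (card {i\<in>D. l dvd i}) - real (card D) / real l"
    using finite_D by (simp add: sum_subtractf of_bool_def sum.If_cases Int_def)
  ultimately show ?thesis by (simp add: mult.commute)
qed

text \<open>The indicator of the residues prime to \<open>E\<close> is the product of \<open>(1 - 1 / l) - \<psi> l\<close> with \<open>\<psi> l\<close> the centred
indicator of the multiples of \<open>l\<close>. Multiplying out, the empty set gives the main term, and each of the
other \<open>2 ^ card E - 1\<close> subsets an error of at most \<open>\<surd>n\<close> times the same product \<open>\<Prod>(1 - 1 / l)\<close>.\<close>
lemma card_coprime_ge:
  assumes fin: "finite E" and E: "\<And>l. l \<in> E \<Longrightarrow> prime l \<and> l dvd Q"
  shows "real (card {i\<in>D. \<forall>l\<in>E. \<not> l dvd i})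
    \<ge> (\<Prod>l\<in>E. 1 - 1 / real l) * (real (card D) - (2 ^ card E - 1) * sqrt (real n))"
proof -
  define \<theta> where "\<theta> = (\<lambda>T. \<Prod>l\<in>T. 1 - 1 / real l)"
  define \<psi> where "\<psi> = (\<lambda>l i. of_bool (l dvd i) - 1 / real l :: real)"
  define S where "S = (\<lambda>T. \<Sum>i\<in>D. \<Prod>l\<in>T. \<psi> l i)"
  have pos: "0 \<le> 1 - 1 / real l" if "l \<in> E" for l
    using prime_gt_0_nat[of l] E[OF that] by (simp add: field_simps)
  have \<theta>0: "\<theta> T \<ge> 0" if "T \<subseteq> E" for T unfolding \<theta>_def using pos that by (intro prod_nonneg) auto
  have Sle: "\<bar>S T\<bar> \<le> sqrt (real n) * \<theta> T" if "T \<subseteq> E" "T \<noteq> {}" for T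
    unfolding S_def \<theta>_def \<psi>_def
    by (rule abs_sum_prod_indicator_le) (use that E finite_subset[OF _ fin] in auto)
  have ind: "of_bool (\<forall>l\<in>E. \<not> l dvd i) = (\<Sum>T\<in>Pow E. (-1) ^ card T * (\<Prod>l\<in>T. \<psi> l i) * \<theta> (E - T))" for i
  proof -
    have "of_bool (\<forall>l\<in>E. \<not> l dvd i) = (\<Prod>l\<in>E. of_bool (\<not> l dvd i) :: real)"
      using fin by (induction E) auto
    also have "\<dots> = (\<Prod>l\<in>E. (1 - 1 / real l) - \<psi> l i)"
      by (intro prod.cong) (auto simp: \<psi>_def)
    also have "\<dots> = (\<Sum>T\<in>Pow E. (-1) ^ card T * (\<Prod>l\<in>T. \<psi> l i) * \<theta> (E - T))"
      unfolding \<theta>_def by (rule prod_diff_conv_sum[OF fin])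
    finally show ?thesis .
  qed
  have "real (card {i\<in>D. \<forall>l\<in>E. \<not> l dvd i}) = (\<Sum>i\<in>D. of_bool (\<forall>l\<in>E. \<not> l dvd i))"
    using finite_D by (simp add: of_bool_def sum.If_cases Int_def)
  also have "\<dots> = (\<Sum>T\<in>Pow E. (-1) ^ card T * S T * \<theta> (E - T))"
    unfolding ind S_def by (subst sum.swap) (simp add: sum_distrib_left sum_distrib_right)
  also have "\<dots> = S {} * \<theta> E + (\<Sum>T\<in>Pow E - {{}}. (-1) ^ card T * S T * \<theta> (E - T))"
    using fin by (subst sum.remove[of _ "{}"]) auto
  also have "\<dots> \<ge> S {} * \<theta> E + (\<Sum>T\<in>Pow E - {{}}. - (sqrt (real n) * \<theta> E))"
  proof (intro add_left_mono sum_mono)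
    fix T assume T: "T \<in> Pow E - {{}}"
    have "\<bar>(-1) ^ card T * S T * \<theta> (E - T)\<bar> = \<bar>S T\<bar> * \<theta> (E - T)"
      using \<theta>0[of "E - T"] by (simp add: abs_mult power_abs)
    also have "\<dots> \<le> sqrt (real n) * \<theta> T * \<theta> (E - T)"
      using T Sle[of T] \<theta>0[of "E - T"] by (intro mult_right_mono) auto
    also have "\<dots> = sqrt (real n) * \<theta> E"
      using prod.subset_diff[of T E "\<lambda>l. 1 - 1 / real l"] T fin by (simp add: \<theta>_def)
    finally show "(-1) ^ card T * S T * \<theta> (E - T) \<ge> - (sqrt (real n) * \<theta> E)" by linarith
  qed
  also have "(\<Sum>T\<in>Pow E - {{}}. - (sqrt (real n) * \<theta> E)) = - ((2 ^ card E - 1) * sqrt (real n) * \<theta> E)"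
    using fin by (simp add: card_Pow of_nat_diff)
  also have "S {} = real (card D)" by (simp add: S_def)
  finally show ?thesis by (simp add: \<theta>_def algebra_simps)
qed

text \<open>Residues that are prime to \<open>E\<close> but not to \<open>Q\<close> are divisible by one of the remaining primes.\<close>
lemma exists_coprime_if_few_multiples:
  assumes "Q > 0"
    and less: "(\<Sum>l\<in>prime_factors Q - E. card {i\<in>D. (\<forall>e\<in>E. \<not> e dvd i) \<and> l dvd i})
      < card {i\<in>D. \<forall>e\<in>E. \<not> e dvd i}"
  shows "\<exists>i\<in>D. coprime i Q"
proof (rule ccontr)
  assume no: "\<not> (\<exists>i\<in>D. coprime i Q)"
  let ?R = "prime_factors Q - E" and ?M = "\<lambda>l. {i\<in>D. (\<forall>e\<in>E. \<not> e dvd i) \<and> l dvd i}"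
  have sub: "{i\<in>D. \<forall>e\<in>E. \<not> e dvd i} \<subseteq> (\<Union>l\<in>?R. ?M l)"
  proof
    fix i assume i: "i \<in> {i\<in>D. \<forall>e\<in>E. \<not> e dvd i}"
    then have "gcd i Q \<noteq> 1" using no by (auto simp: coprime_iff_gcd_eq_1)
    then obtain l where "prime l" "l dvd i" "l dvd Q" using prime_factor_nat[of "gcd i Q"] by auto
    then show "i \<in> (\<Union>l\<in>?R. ?M l)"
      using i \<open>Q > 0\<close> by (auto simp: in_prime_factors_iff)
  qed
  have "card {i\<in>D. \<forall>e\<in>E. \<not> e dvd i} \<le> card (\<Union>l\<in>?R. ?M l)"
    using card_mono[OF _ sub] finite_D by simp
  also have "\<dots> \<le> (\<Sum>l\<in>?R. card (?M l))" by (rule card_UN_le) simp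
  finally show False using less by simp
qed

text \<open>The primes in \<open>E\<close> are sieved out together, at the cost of a factor \<open>2 ^ card E\<close> in the error, and the
others one at a time, at the cost of the density \<open>\<Sum>(1 / l)\<close>. Small primes have large density and belong
in \<open>E\<close>, large ones do not.\<close>
lemma sieve_criterion:
  assumes "Q > 0" and E: "E \<subseteq> prime_factors Q"
    and less: "(\<Sum>l\<in>prime_factors Q - E. real (card D) / real l + (1 - 1 / real l) * sqrt (real n))
      < (\<Prod>l\<in>E. 1 - 1 / real l) * (real (card D) - (2 ^ card E - 1) * sqrt (real n))"
  shows "\<exists>i\<in>D. coprime i Q"
proof (rule exists_coprime_if_few_multiples[OF \<open>Q > 0\<close>, where E = E])
  let ?M = "\<lambda>l. {i\<in>D. (\<forall>e\<in>E. \<not> e dvd i) \<and> l dvd i}"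
  have "real (\<Sum>l\<in>prime_factors Q - E. card (?M l))
      \<le> (\<Sum>l\<in>prime_factors Q - E. real (card D) / real l + (1 - 1 / real l) * sqrt (real n))"
    unfolding of_nat_sum
  proof (rule sum_mono)
    fix l assume l: "l \<in> prime_factors Q - E"
    have "card (?M l) \<le> card {i\<in>D. l dvd i}" using finite_D by (intro card_mono) auto
    also have "real (card {i\<in>D. l dvd i}) \<le> real (card D) / real l + (1 - 1 / real l) * sqrt (real n)"
      using l by (intro card_multiples_le) (auto simp: in_prime_factors_iff)
    finally show "real (card (?M l)) \<le> real (card D) / real l + (1 - 1 / real l) * sqrt (real n)" by simp
  qed
  also note less
  also have "(\<Prod>l\<in>E. 1 - 1 / real l) * (real (card D) - (2 ^ card E - 1) * sqrt (real n))
      \<le> real (card {i\<in>D. \<forall>e\<in>E. \<not> e dvd i})"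
    using E finite_subset[OF E] by (intro card_coprime_ge) (auto simp: in_prime_factors_iff)
  finally show "(\<Sum>l\<in>prime_factors Q - E. card (?M l)) < card {i\<in>D. \<forall>e\<in>E. \<not> e dvd i}"
    by (simp only: of_nat_less_iff)
qed

lemma exists_coprime_if_large:
  assumes "Q > 0" "real (card D) > (2 ^ card (prime_factors Q) - 1) * sqrt (real n)"
  shows "\<exists>i\<in>D. coprime i Q"
proof (rule sieve_criterion[OF \<open>Q > 0\<close> order_refl])
  have "(\<Prod>l\<in>prime_factors Q. 1 - 1 / real l) > 0"
  proof (rule prod_pos)
    fix l assume "l \<in> prime_factors Q"
    then have "l > 1" using prime_gt_1_nat in_prime_factors_imp_prime by blast
    then show "0 < 1 - 1 / real l" by simp
  qed
  then show "(\<Sum>l\<in>prime_factors Q - prime_factors Q. real (card D) / real l + (1 - 1 / real l) * sqrt (real n))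
      < (\<Prod>l\<in>prime_factors Q. 1 - 1 / real l) * (real (card D) - (2 ^ card (prime_factors Q) - 1) * sqrt (real n))"
    using assms(2) by simp
qed

lemma exists_coprime_if_power_le:
  assumes "Q > 0" "4 ^ card (prime_factors Q) \<le> n"
  shows "\<exists>i\<in>D. coprime i Q"
proof (rule exists_coprime_if_large[OF \<open>Q > 0\<close>])
  have "real (4 ^ card (prime_factors Q)) \<le> real n" using assms(2) by (simp only: of_nat_le_iff)
  moreover have "(2 ^ card (prime_factors Q))\<^sup>2 = (4 :: real) ^ card (prime_factors Q)"
    by (simp add: power2_eq_square power_mult_distrib[symmetric])
  ultimately have "(2 ^ card (prime_factors Q))\<^sup>2 \<le> real n" by simp
  then have le: "2 ^ card (prime_factors Q) \<le> sqrt (real n)" by (rule real_le_rsqrt)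
  have "0 < n" using assms(2) by (cases n) auto
  then have "(2 ^ card (prime_factors Q) - 1) * sqrt (real n) < 2 ^ card (prime_factors Q) * sqrt (real n)"
    by simp
  also have "\<dots> \<le> sqrt (real n) * sqrt (real n)" using le by (intro mult_right_mono) auto
  also have "\<dots> \<le> real (card D)" by (simp add: card_D)
  finally show "(2 ^ card (prime_factors Q) - 1) * sqrt (real n) < real (card D)" .
qed

text \<open>Multiplication by \<open>r \<equiv> 2\<close> modulo \<open>3\<close> interchanges the residue classes of \<open>1\<close> and \<open>2\<close>, so they contain
equally many elements of \<open>D\<close>. The cubic character sum is then the integer \<open>N 0 - N 1\<close>, and its absolute
value is known.\<close>
lemma residue_counts_mod_3:
  assumes "3 dvd Q" and r: "r mod 3 = 2" "coprime r Q" and mult: "\<And>i. i \<in> D \<Longrightarrow> (r * i) mod Q \<in> D"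
  defines "N \<equiv> \<lambda>j. card {i\<in>D. i mod 3 = j}"
  shows "N 0 + 2 * N 1 = card D" and "(int (N 0) - int (N 1))\<^sup>2 = int n"
proof -
  have mod3: "((r * i) mod Q) mod 3 = (2 * (i mod 3)) mod 3" for i
  proof -
    have "((r * i) mod Q) mod 3 = (r * i) mod 3" using assms(1) by (simp add: mod_mod_cancel)
    also have "\<dots> = ((r mod 3) * (i mod 3)) mod 3" by (simp add: mod_simps)
    finally show ?thesis using r by simp
  qed
  have inj: "inj_on (\<lambda>i. (r * i) mod Q) D"
  proof (rule inj_onI)
    fix i j assume ij: "i \<in> D" "j \<in> D" "(r * i) mod Q = (r * j) mod Q"
    then have "[i = j] (mod Q)" using cong_mult_lcancel_nat[of r Q i j] r(2) by (simp add: cong_def)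
    moreover have "i < Q" "j < Q" using ij D_subset by auto
    ultimately show "i = j" by (simp add: cong_def)
  qed
  have N12: "N 1 = N 2"
  proof (rule antisym)
    show "N 1 \<le> N 2" unfolding N_def
      by (rule card_inj_on_le[where f = "\<lambda>i. (r * i) mod Q"])
        (use inj mult mod3 finite_D in \<open>auto intro: inj_on_subset\<close>)
    show "N 2 \<le> N 1" unfolding N_def
      by (rule card_inj_on_le[where f = "\<lambda>i. (r * i) mod Q"])
        (use inj mult mod3 finite_D in \<open>auto intro: inj_on_subset\<close>)
  qed
  have part: "(\<Sum>i\<in>D. f i) = (\<Sum>j\<in>{0,1,2}. \<Sum>i\<in>{i\<in>D. i mod 3 = j}. f i)" for f :: "nat \<Rightarrow> 'b::comm_monoid_add"
    by (rule sum.group[symmetric]) (use finite_D in auto)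
  show tot: "N 0 + 2 * N 1 = card D"
    using part[of "\<lambda>_. 1::nat"] N12 by (simp add: N_def)
  define w where "w = prime_root 3"
  have w3: "w ^ 3 = 1" and w1: "w \<noteq> 1"
    using prime_root_power_eq_1_iff[of 3 3] prime_root_power_eq_1_iff[of 3 1] by (auto simp: w_def)
  have "w ^ Q = 1" using prime_root_power_eq_1_iff[of 3 Q] assms(1) by (simp add: w_def)
  have wmod: "w ^ i = w ^ (i mod 3)" for i
  proof -
    have "w ^ i = w ^ (3 * (i div 3) + i mod 3)" by simp
    also have "\<dots> = w ^ (i mod 3)" unfolding power_add power_mult w3 by simp
    finally show ?thesis .
  qed
  have "(\<Sum>t<3. w ^ t) = 0" using w3 w1 by (simp add: sum_gp_strict)
  then have w2: "w ^ 2 = - 1 - w" by (simp add: numeral_3_eq_3 power2_eq_square algebra_simps eq_neg_iff_add_eq_0)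
  have "(\<Sum>i\<in>D. w ^ i) = (\<Sum>j\<in>{0,1,2}. of_nat (N j) * w ^ j)"
    unfolding part
  proof (intro sum.cong refl)
    fix j :: nat
    have "(\<Sum>i\<in>{i\<in>D. i mod 3 = j}. w ^ i) = (\<Sum>i\<in>{i\<in>D. i mod 3 = j}. w ^ j)"
      by (intro sum.cong) (auto simp: wmod[symmetric])
    then show "(\<Sum>i\<in>{i\<in>D. i mod 3 = j}. w ^ i) = of_nat (N j) * w ^ j" by (simp add: N_def)
  qed
  also have "\<dots> = of_real (real (N 0) - real (N 1))"
  proof -
    have "(\<Sum>j\<in>{0,1,2}. of_nat (N j) * w ^ j) = of_nat (N 0) + of_nat (N 1) * (w + w ^ 2)"
      by (simp add: N12[simplified] algebra_simps)
    then show ?thesis by (simp add: w2)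
  qed
  finally have "norm (complex_of_real (real (N 0) - real (N 1))) = sqrt (real n)"
    using norm_character_sum[OF \<open>w ^ Q = 1\<close> w1] by (simp only:)
  then have "\<bar>real (N 0) - real (N 1)\<bar> = sqrt (real n)" by (simp only: norm_of_real)
  then have "\<bar>real (N 0) - real (N 1)\<bar>\<^sup>2 = real n" by simp
  then have "real_of_int ((int (N 0) - int (N 1))\<^sup>2) = real_of_int (int n)" by simp
  then show "(int (N 0) - int (N 1))\<^sup>2 = int n" by (simp only: of_int_eq_iff)
qed

end

section \<open>Few distinct prime factors\<close>

lemma prod_prime_factors_le:
  assumes "n > 0" shows "\<Prod>(prime_factors n) \<le> (n :: nat)"
proof -
  have "\<Prod>(prime_factors n) \<le> (\<Prod>p\<in>prime_factors n. p ^ multiplicity p n)"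
  proof (rule prod_mono)
    fix p assume p: "p \<in> prime_factors n"
    then have "multiplicity p n > 0" by (simp add: prime_factors_multiplicity)
    then show "0 \<le> p \<and> p \<le> p ^ multiplicity p n"
      using prime_gt_0_nat[OF in_prime_factors_imp_prime[OF p]] self_le_power[of p "multiplicity p n"] by simp
  qed
  also have "\<dots> = n" using prime_factorization_nat[OF assms] by simp
  finally show ?thesis .
qed

text \<open>Exchange argument: if \<open>T\<close> lies below \<open>c\<close> and the rest of \<open>S\<close> above it, replacing the elements of \<open>S\<close>
outside \<open>T\<close> by missing elements of \<open>T\<close>, and by copies of \<open>c\<close> once \<open>T\<close> is exhausted, can only
decrease the product. With the smallest admissible primes as \<open>T\<close> this bounds a number from below by
the number of its prime divisors.\<close>
lemma prod_initial_segment_le: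
  fixes S T :: "nat set"
  assumes fin: "finite S" "finite T" and S: "\<And>p. p \<in> S - T \<Longrightarrow> c \<le> p" and T: "\<And>p. p \<in> T \<Longrightarrow> p \<le> c"
    and card: "card T \<le> card S"
  shows "\<Prod>T * c ^ (card S - card T) \<le> \<Prod>S"
proof -
  have cS: "card S = card (S \<inter> T) + card (S - T)"
    using sum.Int_Diff[OF fin(1), of "\<lambda>_. 1 :: nat" T] by simp
  have cT: "card T = card (S \<inter> T) + card (T - S)"
    using sum.Int_Diff[OF fin(2), of "\<lambda>_. 1 :: nat" S] by (simp add: Int_commute)
  have pS: "\<Prod>S = \<Prod>(S \<inter> T) * \<Prod>(S - T)"
    using prod.Int_Diff[OF fin(1), of "\<lambda>x. x" T] by simp
  have pT: "\<Prod>T = \<Prod>(S \<inter> T) * \<Prod>(T - S)"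
    using prod.Int_Diff[OF fin(2), of "\<lambda>x. x" S] by (simp add: Int_commute)
  have "\<Prod>(T - S) * c ^ (card S - card T) \<le> c ^ card (T - S) * c ^ (card S - card T)"
    using prod_mono[of "T - S" "\<lambda>x. x" "\<lambda>_. c"] T by (intro mult_right_mono) auto
  also have "\<dots> = c ^ card (S - T)" unfolding power_add[symmetric] using cS cT card by simp
  also have "\<dots> \<le> \<Prod>(S - T)"
    using prod_mono[of "S - T" "\<lambda>_. c" "\<lambda>x. x"] S by auto
  finally show ?thesis unfolding pS pT by (simp add: mult.assoc)
qed

lemma sum_inverse_initial_segment_le:
  fixes S T :: "nat set"
  assumes fin: "finite S" "finite T" and S: "\<And>p. p \<in> S - T \<Longrightarrow> c \<le> p" and T: "\<And>p. p \<in> T \<Longrightarrow> 0 < p \<and> p \<le> c"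
    and card: "card S \<le> card T" and "c > 0"
  shows "(\<Sum>p\<in>S. 1 / real p) \<le> (\<Sum>p\<in>T. 1 / real p)"
proof -
  have cS: "card S = card (S \<inter> T) + card (S - T)"
    using sum.Int_Diff[OF fin(1), of "\<lambda>_. 1 :: nat" T] by simp
  have cT: "card T = card (S \<inter> T) + card (T - S)"
    using sum.Int_Diff[OF fin(2), of "\<lambda>_. 1 :: nat" S] by (simp add: Int_commute)
  have "(\<Sum>p\<in>S - T. 1 / real p) \<le> (\<Sum>p\<in>S - T. 1 / real c)"
  proof (rule sum_mono)
    fix p assume "p \<in> S - T"
    then have "c \<le> p" by (rule S)
    then show "1 / real p \<le> 1 / real c" using \<open>c > 0\<close> by (intro divide_left_mono) auto
  qed
  also have "\<dots> \<le> (\<Sum>p\<in>T - S. 1 / real c)"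
    using cS cT card by (auto intro!: divide_right_mono)
  also have "\<dots> \<le> (\<Sum>p\<in>T - S. 1 / real p)"
    using T \<open>c > 0\<close> by (intro sum_mono divide_left_mono) auto
  finally have "(\<Sum>p\<in>S \<inter> T. 1 / real p) + (\<Sum>p\<in>S - T. 1 / real p)
      \<le> (\<Sum>p\<in>T \<inter> S. 1 / real p) + (\<Sum>p\<in>T - S. 1 / real p)" by (simp add: Int_commute)
  then show ?thesis
    using sum.Int_Diff[OF fin(1), of "\<lambda>p. 1 / real p" T] sum.Int_Diff[OF fin(2), of "\<lambda>p. 1 / real p" S] by simp
qed

lemma primes_below_67:
  assumes "prime (p :: nat)" "p < 67"
  shows "p \<in> {2, 3, 5, 7, 11, 13, 17, 19, 23, 29, 31, 37, 41, 43, 47, 53, 59, 61}"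
proof -
  let ?P = "{2, 3, 5, 7, 11, 13, 17, 19, 23, 29, 31, 37, 41, 43, 47, 53, 59, 61}"
  have "\<forall>p\<in>set [2..<67]. p \<in> ?P \<or> 2 dvd p \<or> 3 dvd p \<or> 5 dvd p \<or> 7 dvd p"
    by (simp add: upt_rec_numeral del: set_upt)
  moreover have "p \<in> set [2..<67]" using assms prime_ge_2_nat[of p] by (simp del: upt_rec_numeral)
  ultimately have "p \<in> ?P \<or> 2 dvd p \<or> 3 dvd p \<or> 5 dvd p \<or> 7 dvd p" by (rule bspec)
  then show ?thesis
  proof (elim disjE)
    assume "2 dvd p" then show ?thesis using primes_dvd_imp_eq[of 2 p] assms by simp
  next
    assume "3 dvd p" then show ?thesis using primes_dvd_imp_eq[of 3 p] assms by simp
  next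
    assume "5 dvd p" then show ?thesis using primes_dvd_imp_eq[of 5 p] assms by simp
  next
    assume "7 dvd p" then show ?thesis using primes_dvd_imp_eq[of 7 p] assms by simp
  qed
qed

lemma primes_below_19:
  assumes "prime (p :: nat)" "p < 19" shows "p \<in> {2, 3, 5, 7, 11, 13, 17}"
  using primes_below_67[of p] assms by auto

lemma prime_factors_prod_list:
  assumes "n = prod_list ps" "\<forall>p\<in>set ps. prime p"
  shows "prime_factors n = set (ps :: nat list)"
  using assms
proof (induction ps arbitrary: n)
  case (Cons a ps)
  have "0 \<notin> set (a # ps)" using Cons.prems(2) not_prime_0 by blast
  then have "prod_list ps \<noteq> 0" "a \<noteq> 0" by (auto simp: prod_list_zero_iff)
  then have "prime_factors n = prime_factors a \<union> prime_factors (prod_list ps)"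
    using Cons.prems(1) by (simp add: prime_factors_product)
  also have "prime_factors a = {a}" using Cons.prems(2) by (simp add: prime_prime_factors)
  also have "prime_factors (prod_list ps) = set ps" using Cons.IH Cons.prems(2) by simp
  finally show ?case by simp
qed simp

lemma prod_prime_factors_ge:
  assumes "n > 0" "finite T" and T: "\<And>p. p \<in> T \<Longrightarrow> p \<le> c"
    and S: "\<And>p. prime p \<Longrightarrow> p dvd n \<Longrightarrow> p < c \<Longrightarrow> p \<in> T" and le: "card T \<le> card (prime_factors n)"
  shows "\<Prod>T * c ^ (card (prime_factors n) - card T) \<le> (n :: nat)"
proof -
  have "\<Prod>T * c ^ (card (prime_factors n) - card T) \<le> \<Prod>(prime_factors n)"
  proof (rule prod_initial_segment_le[OF _ \<open>finite T\<close> _ T le])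
    show "c \<le> p" if "p \<in> prime_factors n - T" for p
    proof (rule ccontr)
      assume "\<not> c \<le> p"
      then have "p \<in> T" using S[of p] that by (simp add: in_prime_factors_iff)
      then show False using that by simp
    qed
  qed auto
  then show ?thesis using prod_prime_factors_le[OF \<open>n > 0\<close>] by simp
qed

lemma card_prime_factors_less:
  assumes "n > 0" "finite T" and T: "\<And>p. p \<in> T \<Longrightarrow> p \<le> c"
    and S: "\<And>p. prime p \<Longrightarrow> p dvd n \<Longrightarrow> p < c \<Longrightarrow> p \<in> T" and "n < \<Prod>T" and "c > 0"
  shows "card (prime_factors (n :: nat)) < card T"
proof (rule ccontr)
  assume "\<not> ?thesis"
  then have le: "card T \<le> card (prime_factors n)" by simp
  have "\<Prod>T \<le> \<Prod>T * c ^ (card (prime_factors n) - card T)" using \<open>c > 0\<close> by simp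
  also have "\<dots> \<le> n" using prod_prime_factors_ge[OF assms(1-2) T S le] .
  finally show False using assms(5) by simp
qed

text \<open>Modulo \<open>p\<close> the number \<open>q\<close> is a cube root of unity. If \<open>p \<equiv> 2\<close> modulo \<open>3\<close>, cubing is injective modulo \<open>p\<close>,
so \<open>q \<equiv> 1\<close> and \<open>p\<close> divides \<open>3\<close>.\<close>
lemma prime_dvd_square_add_self_add_one:
  assumes p: "prime p" and dvd: "p dvd q ^ 2 + q + 1"
  shows "p = 3 \<or> p mod 3 = (1::nat)"
proof (rule ccontr)
  assume no: "\<not> ?thesis"
  have "p mod 3 \<noteq> 0"
  proof
    assume "p mod 3 = 0"
    then have "3 dvd p" by auto
    then show False using p no primes_dvd_imp_eq[of 3 p] by simp
  qed
  then have "p mod 3 = 2" using no by linarith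
  then obtain j where j: "p = 3 * j + 2" using mult_div_mod_eq[of 3 p] by metis
  have nq: "\<not> p dvd q"
  proof
    assume "p dvd q"
    then have "p dvd q ^ 2 + q" by (simp add: power2_eq_square)
    then have "p dvd 1" using dvd dvd_add_right_iff[of p "q ^ 2 + q" 1] by blast
    then show False using p by simp
  qed
  have pi: "int p dvd (int q)\<^sup>2 + int q + 1" using dvd int_dvd_int_iff[of p "q ^ 2 + q + 1"] by (simp add: ac_simps)
  have "int p dvd ((int q)\<^sup>2 + int q + 1) * (int q - 1)" using pi by simp
  also have "((int q)\<^sup>2 + int q + 1) * (int q - 1) = int q ^ 3 - 1" by (simp add: algebra_simps power2_eq_square power3_eq_cube)
  finally have "[int q ^ 3 = 1] (mod int p)" by (simp add: cong_iff_dvd_diff)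
  then have "[(int q ^ 3) ^ j * int q = 1 ^ j * int q] (mod int p)" by (intro cong_mult cong_pow) auto
  moreover have "[q ^ (p - 1) = 1] (mod p)" using fermat_theorem[OF p nq] .
  then have "[int q ^ (p - 1) = 1] (mod int p)" using cong_int_iff[of "q ^ (p - 1)" 1 p] by simp
  moreover have "int q ^ (p - 1) = (int q ^ 3) ^ j * int q" by (simp add: j power_mult[symmetric] power_add)
  ultimately have "[int q = 1] (mod int p)" by (simp add: cong_def)
  then have "[(int q)\<^sup>2 + int q + 1 = 1\<^sup>2 + 1 + 1] (mod int p)" by (intro cong_add cong_pow) auto
  then have "int p dvd 1\<^sup>2 + 1 + 1" using pi cong_dvd_iff by blast
  then have "p dvd 3" using int_dvd_int_iff[of p 3] by simp
  then show False using p no primes_dvd_imp_eq[of p 3] by simp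
qed

text \<open>If \<open>p \<equiv> 3\<close> modulo \<open>4\<close>, Fermat's theorem and \<open>q^4 \<equiv> 1\<close> give \<open>q\<^sup>2 \<equiv> 1\<close>, while \<open>q\<^sup>2 \<equiv> -1\<close>.\<close>
lemma prime_dvd_square_add_one:
  assumes p: "prime p" and dvd: "p dvd q ^ 2 + 1"
  shows "p = 2 \<or> p mod 4 = (1::nat)"
proof (rule ccontr)
  assume no: "\<not> ?thesis"
  then have "odd p" using prime_odd_nat[OF p] prime_ge_2_nat[OF p] by (cases "p = 2") auto
  then have "p mod 4 = 3" using no by presburger
  then obtain j where j: "p = 4 * j + 3" using mult_div_mod_eq[of 4 p] by metis
  have nq: "\<not> p dvd q"
  proof
    assume "p dvd q"
    then have "p dvd q ^ 2" by (simp add: power2_eq_square)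
    then have "p dvd 1" using dvd dvd_add_right_iff[of p "q ^ 2" 1] by blast
    then show False using p by simp
  qed
  have pi: "int p dvd (int q)\<^sup>2 + 1" using dvd int_dvd_int_iff[of p "q ^ 2 + 1"] by (simp add: ac_simps)
  have "int p dvd ((int q)\<^sup>2 + 1) * ((int q)\<^sup>2 - 1)" using pi by simp
  also have "((int q)\<^sup>2 + 1) * ((int q)\<^sup>2 - 1) = int q ^ 4 - 1" by (simp add: algebra_simps power2_eq_square power4_eq_xxxx)
  finally have "[int q ^ 4 = 1] (mod int p)" by (simp add: cong_iff_dvd_diff)
  then have "[(int q ^ 4) ^ j * (int q)\<^sup>2 = 1 ^ j * (int q)\<^sup>2] (mod int p)" by (intro cong_mult cong_pow) auto
  moreover have "[q ^ (p - 1) = 1] (mod p)" using fermat_theorem[OF p nq] .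
  then have "[int q ^ (p - 1) = 1] (mod int p)" using cong_int_iff[of "q ^ (p - 1)" 1 p] by simp
  moreover have "int q ^ (p - 1) = (int q ^ 4) ^ j * (int q)\<^sup>2"
    by (simp add: j power_mult[symmetric] power_add power2_eq_square)
  ultimately have "[(int q)\<^sup>2 = 1] (mod int p)" by (simp add: cong_def)
  then have "int p dvd (int q)\<^sup>2 - 1" by (simp add: cong_iff_dvd_diff)
  from dvd_diff[OF pi this] have "int p dvd 2" by simp
  then have "p dvd 2" using int_dvd_int_iff[of p 2] by simp
  then show False using p no primes_dvd_imp_eq[of p 2] by simp
qed

section \<open>Prime factors of repunits\<close>

text \<open>Trial division by the primes below \<open>67\<close> decides primality below \<open>67\<^sup>2 = 4489\<close>. As a rewrite rule this
replaces the default one, which tries every divisor up to half the number.\<close>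
lemma prime_nat_below_4489:
  assumes "1 < n" "n < (4489 :: nat)"
  shows "prime n \<longleftrightarrow> n \<in> {2, 3, 5, 7, 11, 13, 17, 19, 23, 29, 31, 37, 41, 43, 47, 53, 59, 61} \<or>
    (\<forall>p\<in>{2, 3, 5, 7, 11, 13, 17, 19, 23, 29, 31, 37, 41, 43, 47, 53, 59, 61}. \<not> p dvd n)"
    (is "_ \<longleftrightarrow> n \<in> ?P \<or> _")
proof
  assume n: "prime n"
  show "n \<in> ?P \<or> (\<forall>p\<in>?P. \<not> p dvd n)"
  proof (cases "n < 67")
    case True then show ?thesis using primes_below_67[OF n] by blast
  next
    case False
    have "\<not> p dvd n" if p: "p \<in> ?P" for p
    proof
      assume "p dvd n"
      then have "p = 1 \<or> p = n" using n by (simp add: prime_nat_iff)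
      then show False using p False by (elim insertE) auto
    qed
    then show ?thesis by blast
  qed
next
  have P: "prime p" if "p \<in> ?P" for p using that by (elim insertE) simp_all
  assume n: "n \<in> ?P \<or> (\<forall>p\<in>?P. \<not> p dvd n)"
  show "prime n"
  proof (cases "n \<in> ?P")
    case True then show ?thesis by (rule P)
  next
    case False
    then have nd: "\<not> p dvd n" if "p \<in> ?P" for p using n that by blast
    obtain p where p: "prime p" "p dvd n" using prime_factor_nat[of n] assms by auto
    have large: "67 \<le> r" if "prime r" "r dvd n" for r
      using primes_below_67[OF that(1)] nd that(2) by (meson not_le)
    obtain k where k: "n = p * k" using p(2) ..
    have "k = 1"
    proof (rule ccontr)
      assume "k \<noteq> 1"
      then obtain r where "prime r" "r dvd k" using prime_factor_nat[of k] by auto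
      moreover have "k > 0" using k assms by (cases k) auto
      ultimately have "67 \<le> r" "r \<le> k" using large[of r] k dvd_imp_le[of r k] by auto
      then have "67 * 67 \<le> p * k" using large[OF p] by (intro mult_le_mono) auto
      then show False using k assms by simp
    qed
    then show ?thesis using k p by simp
  qed
qed

declare prime_nat_numeral_eq [simp del] prime_nat_below_4489 [simp]

lemma power_power_swap: "(a ^ b) ^ c = (a ^ c) ^ b" for a :: "'a :: monoid_mult"
  by (metis mult.commute power_mult)

lemma power_le_by_list:
  assumes "Q = prod_list ps" "\<And>p. p \<in> set ps \<Longrightarrow> prime p" "(b :: nat) ^ card (set (ps :: nat list)) \<le> u"
  shows "b ^ card (prime_factors Q) \<le> u"
proof -
  have "prime_factors Q = set ps" using assms(1,2) by (intro prime_factors_prod_list) auto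
  then show ?thesis using assms(3) by simp
qed

lemma primorial_le:
  assumes "n > 0" "card (prime_factors n) = 7 + j" shows "510510 * 19 ^ j \<le> (n :: nat)"
proof -
  let ?T = "{2, 3, 5, 7, 11, 13, 17 :: nat}"
  have "\<Prod>?T * 19 ^ (card (prime_factors n) - card ?T) \<le> n"
  proof (rule prod_prime_factors_ge[OF \<open>n > 0\<close>])
    show "p \<in> ?T" if "prime p" "p < 19" for p using primes_below_19 that by blast
  qed (use assms in auto)
  then show ?thesis using assms by simp
qed

lemma odd_primorial_le:
  assumes "odd n" "card (prime_factors n) = 6 + j" shows "255255 * 19 ^ j \<le> (n :: nat)"
proof -
  let ?T = "{3, 5, 7, 11, 13, 17 :: nat}"
  have "\<Prod>?T * 19 ^ (card (prime_factors n) - card ?T) \<le> n"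
  proof (rule prod_prime_factors_ge)
    show "n > 0" using assms by (cases n) auto
    show "p \<in> ?T" if "prime p" "p dvd n" "p < 19" for p 
      using primes_below_19[of p] that assms(1) by auto
  qed (use assms in auto)
  then show ?thesis using assms by simp
qed

text \<open>The product of the six smallest primes is \<open>30030\<close>, so a smaller number has at most five prime divisors.\<close>
lemma power_le_by_size:
  assumes "(Q :: nat) > 0" "Q < 30030" "(b :: nat) ^ 5 \<le> u" "b > 0"
  shows "b ^ card (prime_factors Q) \<le> u"
proof -
  let ?T = "{2, 3, 5, 7, 11, 13 :: nat}"
  have "card (prime_factors Q) < card ?T"
  proof (rule card_prime_factors_less[OF \<open>Q > 0\<close>])
    show "p \<in> ?T" if "prime p" "p < 17" for p using primes_below_19[of p] that by auto
  qed (use assms in auto)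
  then have "b ^ card (prime_factors Q) \<le> b ^ 5"
    using assms(4) by (intro power_increasing) auto
  then show ?thesis using assms(3) by simp
qed

lemma repunit_bounds:
  fixes q m Q :: nat
  assumes "q \<ge> 2" "m \<ge> 1" "Q * (q - 1) = q ^ m - 1"
  shows "Q > 0" "Q < 2 * q ^ (m - 1)"
proof -
  have "q ^ m \<ge> 2" using assms self_le_power[of q m] by simp
  then show "Q > 0" using assms by (cases Q) auto
  have "q ^ m = q * q ^ (m - 1)" using assms(2) by (cases m) auto
  then have "Q * (q - 1) < q * q ^ (m - 1)" using assms(3) \<open>q ^ m \<ge> 2\<close> by simp
  also have "\<dots> \<le> (2 * (q - 1)) * q ^ (m - 1)" using assms(1) by (intro mult_right_mono) auto
  finally have "Q * (q - 1) < (2 * q ^ (m - 1)) * (q - 1)" by (simp add: ac_simps)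
  then show "Q < 2 * q ^ (m - 1)" by simp
qed

lemma repunit_eq_sum:
  assumes "Q * (q - 1) = q ^ m - (1::nat)" "q \<ge> 2"
  shows "Q = (\<Sum>i<m. q ^ i)"
proof -
  obtain r where r: "q = Suc r" using assms(2) by (cases q) auto
  have "r * (\<Sum>i<m. q ^ i) + 1 = q ^ m" by (induction m) (auto simp: r algebra_simps)
  then have "(q - 1) * (\<Sum>i<m. q ^ i) = q ^ m - 1" using r by simp
  then have "(q - 1) * (\<Sum>i<m. q ^ i) = (q - 1) * Q" using assms(1) by (simp add: mult.commute)
  then show ?thesis using assms(2) by simp
qed

lemma odd_repunit:
  assumes "odd m" "Q * (q - 1) = q ^ m - (1::nat)" "q \<ge> 2"
  shows "odd Q"
proof -
  have "odd (\<Sum>i<m. q ^ i)"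
  proof (cases "even q")
    case True
    have "odd (\<Sum>i<Suc k. q ^ i)" for k
      by (induction k) (use True in auto)
    then show ?thesis using assms(1) by (cases m) (auto simp del: sum.lessThan_Suc)
  next
    case False
    have "even (\<Sum>i<k. q ^ i) \<longleftrightarrow> even k" for k by (induction k) (use False in auto)
    then show ?thesis using assms(1) by simp
  qed
  then show ?thesis using repunit_eq_sum[OF assms(2,3)] by simp
qed

text \<open>If the claim failed, the upper bound \<open>32 * (q^(m-2))^6\<close> for \<open>Q^5\<close> would be less than
\<open>32 * 4096^w\<close>, where \<open>w\<close> is the number of prime divisors of \<open>Q\<close>. For \<open>w \<ge> 7\<close> this is less than the fifth
power of the product of the smallest \<open>w\<close> primes. For \<open>w \<le> 6\<close> it leaves \<open>q^(m-2) < 4096\<close> and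
hence a dozen pairs, for which \<open>Q\<close> is factored or is too small to have many prime divisors.\<close>
lemma omega_bound_ge_7:
  fixes q m Q :: nat
  assumes q: "q \<ge> 2" and m: "m \<ge> 7" and Q: "Q * (q - 1) = q ^ m - 1"
  shows "4 ^ card (prime_factors Q) \<le> q ^ (m - 2)"
proof (rule ccontr)
  define w where "w = card (prime_factors Q)"
  define u where "u = q ^ (m - 2)"
  assume "\<not> ?thesis"
  then have less: "u < 4 ^ w" by (simp add: u_def w_def)
  have "m \<ge> 1" using m by simp
  note Qb = repunit_bounds[OF q this Q]
  have "Q ^ 5 \<le> (2 * q ^ (m - 1)) ^ 5" using Qb by (intro power_mono) auto
  also have "\<dots> = 32 * q ^ (5 * (m - 1))" by (simp add: power_mult_distrib power_mult[symmetric] mult.commute)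
  also have "\<dots> \<le> 32 * q ^ (6 * (m - 2))" using q m by (intro mult_left_mono power_increasing) auto
  also have "q ^ (6 * (m - 2)) = u ^ 6" by (simp add: u_def power_mult[symmetric] mult.commute)
  finally have up: "Q ^ 5 \<le> 32 * u ^ 6" .
  have "w \<le> 6"
  proof (rule ccontr)
    assume "\<not> w \<le> 6"
    then obtain j where j: "w = 7 + j" using le_Suc_ex[of 7 w] by auto
    have "510510 * 19 ^ j \<le> Q" using primorial_le[OF Qb(1)] j by (simp add: w_def)
    then have "(510510 * 19 ^ j) ^ 5 \<le> Q ^ 5" by (intro power_mono) auto
    also have "\<dots> \<le> 32 * u ^ 6" by (rule up)
    also have "\<dots> \<le> 32 * (4 ^ w) ^ 6" using less by (intro mult_left_mono power_mono) auto
    also have "\<dots> = 32 * 4096 ^ 7 * 4096 ^ j" by (simp add: j power_power_swap[of 4 _ 6] power_add)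
    finally have "510510 ^ 5 * (19 ^ 5) ^ j \<le> 32 * 4096 ^ 7 * (4096 :: nat) ^ j"
      by (simp only: power_mult_distrib power_power_swap[of 19 j])
    moreover have "32 * 4096 ^ 7 * (4096 :: nat) ^ j \<le> 32 * 4096 ^ 7 * (19 ^ 5) ^ j"
      by (intro mult_left_mono power_mono) auto
    ultimately have "510510 ^ 5 * (19 ^ 5) ^ j \<le> 32 * 4096 ^ 7 * ((19 :: nat) ^ 5) ^ j" by (rule order_trans)
    then show False by simp
  qed
  then have "(4 :: nat) ^ w \<le> 4 ^ 6" by (intro power_increasing) auto
  then have u: "u < 4096" using less by simp
  have "q \<le> 5"
  proof (rule ccontr)
    assume "\<not> q \<le> 5"
    then have "6 ^ 5 \<le> q ^ 5" by (intro power_mono) auto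
    also have "\<dots> \<le> u" unfolding u_def using q m by (intro power_increasing) auto
    finally show False using u by simp
  qed
  then have qs: "q \<in> {2, 3, 4, 5}" using q by auto
  have mle: "m - 2 < e" if "4096 \<le> q ^ e" for e
    using u that power_increasing[of e "m - 2" q] q unfolding u_def by linarith
  have cases: "(q, m) \<in> {(2,7), (2,8), (2,9), (2,10), (2,11), (2,12), (2,13), (3,7), (3,8), (3,9), (4,7), (5,7)}"
    using qs
  proof (elim insertE emptyE)
    assume "q = 2" then show ?thesis using mle[of 12] m by auto
  next
    assume "q = 3" then show ?thesis using mle[of 8] m by auto
  next
    assume "q = 4" then show ?thesis using mle[of 6] m by auto
  next
    assume "q = 5" then show ?thesis using mle[of 6] m by auto
  qed
  have "4 ^ card (prime_factors Q) \<le> q ^ (m - 2)"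
    using cases
  proof (elim insertE emptyE)
    assume "(q, m) = (2, 7)" then show ?thesis using Q by (intro power_le_by_list[where ps = "[127]"]) auto
  next
    assume "(q, m) = (2, 8)" then show ?thesis using Q by (intro power_le_by_list[where ps = "[3, 5, 17]"]) auto
  next
    assume "(q, m) = (2, 9)" then show ?thesis using Q by (intro power_le_by_list[where ps = "[7, 73]"]) auto
  next
    assume "(q, m) = (2, 10)" then show ?thesis using Q by (intro power_le_by_list[where ps = "[3, 11, 31]"]) auto
  next
    assume "(q, m) = (2, 11)" then show ?thesis using Q by (intro power_le_by_list[where ps = "[23, 89]"]) auto
  next
    assume "(q, m) = (3, 7)" then show ?thesis using Q by (intro power_le_by_list[where ps = "[1093]"]) auto
  next
    assume "(q, m) = (3, 8)" then show ?thesis using Q by (intro power_le_by_list[where ps = "[2, 2, 2, 2, 5, 41]"]) auto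
  qed (use Q in \<open>auto intro!: power_le_by_size\<close>)
  then show False using less by (simp add: u_def w_def)
qed

text \<open>The method is that of \<open>omega_bound_ge_7\<close>, applied to \<open>Q\<^sup>2\<close> instead of \<open>Q^5\<close>.\<close>
lemma omega_bound_6:
  fixes q Q :: nat
  assumes q: "q \<ge> 2" and Q: "Q * (q - 1) = q ^ 6 - 1"
  shows "4 ^ card (prime_factors Q) \<le> q ^ 4"
proof -
  define w where "w = card (prime_factors Q)"
  have "2 ^ w \<le> q\<^sup>2"
  proof (rule ccontr)
    assume "\<not> ?thesis"
    then have less: "q\<^sup>2 < 2 ^ w" by simp
    have Qb: "Q > 0" "Q < 2 * q ^ 5" using repunit_bounds[OF q _ Q] by auto
    have "Q ^ 2 \<le> (2 * q ^ 5) ^ 2" using Qb by (intro power_mono) auto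
    also have "\<dots> = 4 * (q\<^sup>2) ^ 5" by (simp add: power_mult_distrib power_mult[symmetric])
    finally have up: "Q ^ 2 \<le> 4 * (q\<^sup>2) ^ 5" .
    have "w \<le> 6"
    proof (rule ccontr)
      assume "\<not> w \<le> 6"
      then obtain j where j: "w = 7 + j" using le_Suc_ex[of 7 w] by auto
      have "510510 * 19 ^ j \<le> Q" using primorial_le[OF Qb(1)] j by (simp add: w_def)
      then have "(510510 * 19 ^ j) ^ 2 \<le> Q ^ 2" by (intro power_mono) auto
      also have "\<dots> \<le> 4 * (q\<^sup>2) ^ 5" by (rule up)
      also have "\<dots> \<le> 4 * (2 ^ w) ^ 5" using less by (intro mult_left_mono power_mono) auto
      also have "\<dots> = 4 * 32 ^ 7 * 32 ^ j" by (simp add: j power_power_swap[of 2 _ 5] power_add)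
      finally have "510510 ^ 2 * (19 ^ 2) ^ j \<le> 4 * 32 ^ 7 * (32 :: nat) ^ j"
        by (simp only: power_mult_distrib power_power_swap[of 19 j])
      moreover have "4 * 32 ^ 7 * (32 :: nat) ^ j \<le> 4 * 32 ^ 7 * (19 ^ 2) ^ j"
        by (intro mult_left_mono power_mono) auto
      ultimately have "510510 ^ 2 * (19 ^ 2) ^ j \<le> 4 * 32 ^ 7 * ((19 :: nat) ^ 2) ^ j" by (rule order_trans)
      then show False by simp
    qed
    then have "(2 :: nat) ^ w \<le> 2 ^ 6" by (intro power_increasing) auto
    then have "q\<^sup>2 < 8\<^sup>2" using less by simp
    then have "q < 8" using power_less_imp_less_base by blast
    then have "q \<in> {2, 3, 4, 5, 6, 7}" using q by auto
    then have "2 ^ card (prime_factors Q) \<le> q\<^sup>2"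
    proof (elim insertE emptyE)
      assume "q = 2" then show ?thesis using Q by (intro power_le_by_list[where ps = "[3, 3, 7]"]) auto
    next
      assume "q = 3" then show ?thesis using Q by (intro power_le_by_list[where ps = "[2, 2, 7, 13]"]) auto
    next
      assume "q = 4" then show ?thesis using Q by (intro power_le_by_list[where ps = "[3, 5, 7, 13]"]) auto
    next
      assume "q = 5" then show ?thesis using Q by (intro power_le_by_list[where ps = "[2, 3, 3, 7, 31]"]) auto
    qed (use Q in \<open>auto intro!: power_le_by_size\<close>)
    then show False using less by (simp add: w_def)
  qed
  then have "(2 ^ w)\<^sup>2 \<le> (q\<^sup>2)\<^sup>2" by (intro power_mono) auto
  then show ?thesis by (simp add: w_def power_mult[symmetric] power2_eq_square power_mult_distrib[symmetric])
    (simp add: power4_eq_xxxx mult.assoc)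
qed

text \<open>Here \<open>Q\<close> is odd, and the product of the six smallest odd primes already suffices for the
comparison with \<open>Q^3\<close>.\<close>
lemma omega_bound_5:
  fixes q Q :: nat
  assumes q: "q \<ge> 2" and Q: "Q * (q - 1) = q ^ 5 - 1"
  shows "4 ^ card (prime_factors Q) \<le> q ^ 3"
proof (rule ccontr)
  define w where "w = card (prime_factors Q)"
  assume "\<not> ?thesis"
  then have less: "q ^ 3 < 4 ^ w" by (simp add: w_def)
  have Qb: "Q > 0" "Q < 2 * q ^ 4" using repunit_bounds[OF q _ Q] by auto
  have odd: "odd Q" using odd_repunit[OF _ Q q] by simp
  have "Q ^ 3 \<le> (2 * q ^ 4) ^ 3" using Qb by (intro power_mono) auto
  also have "\<dots> = 8 * (q ^ 3) ^ 4" by (simp add: power_mult_distrib power_mult[symmetric])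
  finally have up: "Q ^ 3 \<le> 8 * (q ^ 3) ^ 4" .
  have "w \<le> 5"
  proof (rule ccontr)
    assume "\<not> w \<le> 5"
    then obtain j where j: "w = 6 + j" using le_Suc_ex[of 6 w] by auto
    have "255255 * 19 ^ j \<le> Q" using odd_primorial_le[OF odd] j by (simp add: w_def)
    then have "(255255 * 19 ^ j) ^ 3 \<le> Q ^ 3" by (intro power_mono) auto
    also have "\<dots> \<le> 8 * (q ^ 3) ^ 4" by (rule up)
    also have "\<dots> \<le> 8 * (4 ^ w) ^ 4" using less by (intro mult_left_mono power_mono) auto
    also have "\<dots> = 8 * 256 ^ 6 * 256 ^ j" by (simp add: j power_power_swap[of 4 _ 4] power_add)
    finally have "255255 ^ 3 * (19 ^ 3) ^ j \<le> 8 * 256 ^ 6 * (256 :: nat) ^ j"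
      by (simp only: power_mult_distrib power_power_swap[of 19 j])
    moreover have "8 * 256 ^ 6 * (256 :: nat) ^ j \<le> 8 * 256 ^ 6 * (19 ^ 3) ^ j"
      by (intro mult_left_mono power_mono) auto
    ultimately have "255255 ^ 3 * (19 ^ 3) ^ j \<le> 8 * 256 ^ 6 * ((19 :: nat) ^ 3) ^ j" by (rule order_trans)
    then show False by simp
  qed
  then have "(4 :: nat) ^ w \<le> 4 ^ 5" by (intro power_increasing) auto
  then have "q ^ 3 < 11 ^ 3" using less by simp
  then have "q < 11" using power_less_imp_less_base by blast
  then have "q \<in> {2, 3, 4, 5, 6, 7, 8, 9, 10}" using q by auto
  then have "4 ^ card (prime_factors Q) \<le> q ^ 3"
  proof (elim insertE emptyE)
    assume "q = 2" then show ?thesis using Q by (intro power_le_by_list[where ps = "[31]"]) auto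
  next
    assume "q = 3" then show ?thesis using Q by (intro power_le_by_list[where ps = "[11, 11]"]) auto
  next
    assume "q = 4" then show ?thesis using Q by (intro power_le_by_list[where ps = "[11, 31]"]) auto
  next
    assume "q = 5" then show ?thesis using Q by (intro power_le_by_list[where ps = "[11, 71]"]) auto
  next
    assume "q = 6" then show ?thesis using Q by (intro power_le_by_list[where ps = "[5, 311]"]) auto
  next
    assume "q = 7" then show ?thesis using Q by (intro power_le_by_list[where ps = "[2801]"]) auto
  next
    assume "q = 8" then show ?thesis using Q by (intro power_le_by_list[where ps = "[31, 151]"]) auto
  next
    assume "q = 9" then show ?thesis using Q by (intro power_le_by_list[where ps = "[11, 11, 61]"]) auto
  next
    assume "q = 10" then show ?thesis using Q by (intro power_le_by_list[where ps = "[41, 271]"]) auto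
  qed
  then show False using less by (simp add: w_def)
qed

text \<open>Size alone only gives at most eight prime divisors, hence \<open>q \<le> 253\<close>. An even \<open>q\<close> is then one of seven
powers of \<open>2\<close>. For odd \<open>q\<close> the prime divisors of
\<open>q + 1\<close> and those of the odd number \<open>r = (q\<^sup>2 + 1) / 2\<close> are counted separately; the latter are congruent
to \<open>1\<close> modulo \<open>4\<close> and therefore scarce. Two rounds of this reduce the claim to \<open>q \<le> 61\<close>.\<close>
lemma omega_bound_4:
  fixes q Q :: nat
  assumes pp: "primepow q" and q: "q \<noteq> 5" "q \<noteq> 13" and Q: "Q = (q + 1) * (q\<^sup>2 + 1)"
  shows "2 ^ card (prime_factors Q) \<le> q + 2"
proof (rule ccontr)
  define w where "w = card (prime_factors Q)"
  assume "\<not> ?thesis"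
  then have less: "q + 2 < 2 ^ w" by (simp add: w_def)
  have q2: "q \<ge> 2" using primepow_gt_Suc_0[OF pp] by simp
  have Q0: "Q > 0" by (simp add: Q)
  have "w \<le> 8"
  proof (rule ccontr)
    assume "\<not> w \<le> 8"
    then obtain j where j: "w = 9 + j" using le_Suc_ex[of 9 w] by auto
    let ?T = "{2, 3, 5, 7, 11, 13, 17, 19, 23 :: nat}"
    have "\<Prod>?T * 29 ^ (w - card ?T) \<le> Q" unfolding w_def
    proof (rule prod_prime_factors_ge[OF Q0])
      show "p \<in> ?T" if "prime p" "p < 29" for p using primes_below_67[of p] that by auto
    qed (use j in \<open>auto simp: w_def\<close>)
    then have "223092870 * 29 ^ j \<le> Q" by (simp add: j)
    also have "\<dots> \<le> (q + 1) ^ 3"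
      by (simp add: Q power2_eq_square power3_eq_cube algebra_simps)
    also have "\<dots> \<le> (2 ^ w) ^ 3" using less by (intro power_mono) auto
    also have "\<dots> = 134217728 * 8 ^ j" by (simp add: j power_power_swap[of 2 _ 3] power_add)
    also have "\<dots> \<le> 134217728 * 29 ^ j" by (intro mult_left_mono power_mono) auto
    finally show False by simp
  qed
  then have "(2 :: nat) ^ w \<le> 2 ^ 8" by (intro power_increasing) auto
  then have q253: "q \<le> 253" using less by simp
  show False
  proof (cases "even q")
    case True
    obtain p a where pa: "prime p" "a > 0" "q = p ^ a" using pp by (auto simp: primepow_def)
    then have "p = 2" using True by (metis even_power primes_dvd_imp_eq two_is_prime_nat)
    then have qa: "q = 2 ^ a" using pa by simp
    have "a < 8"
    proof (rule ccontr)
      assume "\<not> a < 8"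
      then have "(2 :: nat) ^ 8 \<le> 2 ^ a" by (intro power_increasing) auto
      then show False using qa q253 by simp
    qed
    then have "a \<in> {1, 2, 3, 4, 5, 6, 7}" using pa(2) by auto
    then have "2 ^ card (prime_factors Q) \<le> q + 2"
    proof (elim insertE emptyE)
      assume "a = 1" then show ?thesis by (intro power_le_by_list[where ps = "[3, 5]"]) (auto simp: Q qa)
    next
      assume "a = 2" then show ?thesis by (intro power_le_by_list[where ps = "[5, 17]"]) (auto simp: Q qa)
    next
      assume "a = 3" then show ?thesis by (intro power_le_by_list[where ps = "[3, 3, 5, 13]"]) (auto simp: Q qa)
    next
      assume "a = 4" then show ?thesis by (intro power_le_by_list[where ps = "[17, 257]"]) (auto simp: Q qa)
    next
      assume "a = 5" then show ?thesis by (intro power_le_by_list[where ps = "[3, 11, 5, 5, 41]"]) (auto simp: Q qa)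
    next
      assume "a = 6" then show ?thesis by (intro power_le_by_list[where ps = "[5, 13, 17, 241]"]) (auto simp: Q qa)
    next
      assume "a = 7" then show ?thesis by (intro power_le_by_list[where ps = "[3, 43, 5, 29, 113]"]) (auto simp: Q qa)
    qed
    then show False using less by (simp add: w_def)
  next
    case False
    then obtain t where t: "q = 2 * t + 1" by (elim oddE)
    define r where "r = 2 * t\<^sup>2 + 2 * t + 1"
    have r: "q\<^sup>2 + 1 = 2 * r" by (simp add: t r_def power2_eq_square algebra_simps)
    have "odd r" by (simp add: r_def)
    have r0: "r > 0" by (simp add: r_def)
    define s1 s2 where "s1 = card (prime_factors (q + 1))" and "s2 = card (prime_factors r)"
    have "2 \<in> prime_factors (q + 1)" using False by (simp add: in_prime_factors_iff)
    moreover have "prime_factors Q = prime_factors (q + 1) \<union> (prime_factors 2 \<union> prime_factors r)"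
      using prime_factors_product[of "q + 1" "2 * r"] prime_factors_product[of 2 r] r0 unfolding Q r by simp
    ultimately have "prime_factors Q = prime_factors (q + 1) \<union> prime_factors r"
      by (auto simp only: prime_prime_factors[OF two_is_prime_nat])
    then have w: "w \<le> s1 + s2" unfolding w_def s1_def s2_def by (simp add: card_Un_le)
    have s1: "s1 < 5"
    proof -
      let ?T = "{2, 3, 5, 7, 11 :: nat}"
      have "s1 < card ?T" unfolding s1_def
      proof (rule card_prime_factors_less)
        show "p \<in> ?T" if "prime p" "p < 13" for p using primes_below_19[of p] that by auto
      qed (use q253 in auto)
      then show ?thesis by simp
    qed
    have s2: "s2 < 4"
    proof -
      let ?T = "{5, 13, 17, 29 :: nat}"
      have "q\<^sup>2 \<le> 253\<^sup>2" using q253 by (intro power_mono) auto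
      then have rb: "r < 32045" using r by simp
      have "s2 < card ?T" unfolding s2_def
      proof (rule card_prime_factors_less[OF r0])
        fix p assume p: "prime p" "p dvd r" "p < 37"
        then have "p dvd q\<^sup>2 + 1" using r by simp
        then have "p = 2 \<or> p mod 4 = 1" by (rule prime_dvd_square_add_one[OF p(1)])
        moreover have "p \<noteq> 2" using p(2) \<open>odd r\<close> by auto
        ultimately show "p \<in> ?T" using primes_below_67[OF p(1)] p(3) by auto
      qed (use rb in auto)
      then show ?thesis by simp
    qed
    have "w \<le> 7" using w s1 s2 by simp
    then have "(2 :: nat) ^ w \<le> 2 ^ 7" by (intro power_increasing) auto
    then have q125: "q \<le> 125" using less by simp
    have s1: "s1 < 4"
    proof -
      let ?T = "{2, 3, 5, 7 :: nat}"
      have "s1 < card ?T" unfolding s1_def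
      proof (rule card_prime_factors_less)
        show "p \<in> ?T" if "prime p" "p < 11" for p using primes_below_19[of p] that by auto
      qed (use q125 in auto)
      then show ?thesis by simp
    qed
    have "w \<le> 6" using w s1 s2 by simp
    then have "(2 :: nat) ^ w \<le> 2 ^ 6" by (intro power_increasing) auto
    then have "q \<le> 61" using less by simp
    then have "t = 1 \<or> t \<in> set [2..<31]" using q2 t by (auto simp del: upt_rec_numeral)
    then have "t \<in> {1, 2, 3, 4, 5, 6, 7, 8, 9, 10, 11, 12, 13, 14, 15, 16, 17, 18, 19, 20, 21, 22, 23, 24,
        25, 26, 27, 28, 29, 30}" by (simp add: upt_rec_numeral del: set_upt)
    moreover have "t \<noteq> 2" "t \<noteq> 6" using q t by auto
    ultimately have "t \<in> {1, 3, 4, 5, 7, 8, 9, 10, 11, 12, 13, 14, 15, 16, 17, 18, 19, 20, 21, 22, 23, 24,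
        25, 26, 27, 28, 29, 30}" by blast
    then have "2 ^ card (prime_factors Q) \<le> q + 2"
    proof (elim insertE emptyE)
      assume "t = 1" then show ?thesis by (intro power_le_by_list[where ps = "[2, 2, 2, 5]"]) (auto simp: Q t)
    next
      assume "t = 3" then show ?thesis by (intro power_le_by_list[where ps = "[2, 2, 2, 2, 5, 5]"]) (auto simp: Q t)
    next
      assume "t = 4" then show ?thesis by (intro power_le_by_list[where ps = "[2, 2, 5, 41]"]) (auto simp: Q t)
    next
      assume "t = 5" then show ?thesis by (intro power_le_by_list[where ps = "[2, 2, 2, 3, 61]"]) (auto simp: Q t)
    next
      assume "t = 7" then show ?thesis by (intro power_le_by_list[where ps = "[2, 2, 2, 2, 2, 113]"]) (auto simp: Q t)
    next
      assume "t = 8" then show ?thesis by (intro power_le_by_list[where ps = "[2, 2, 3, 3, 5, 29]"]) (auto simp: Q t)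
    next
      assume "t = 9" then show ?thesis by (intro power_le_by_list[where ps = "[2, 2, 2, 5, 181]"]) (auto simp: Q t)
    next
      assume "t = 10" then show ?thesis by (intro power_le_by_list[where ps = "[2, 2, 11, 13, 17]"]) (auto simp: Q t)
    next
      assume "t = 11" then show ?thesis by (intro power_le_by_list[where ps = "[2, 2, 2, 2, 3, 5, 53]"]) (auto simp: Q t)
    next
      assume "t = 12" then show ?thesis by (intro power_le_by_list[where ps = "[2, 2, 13, 313]"]) (auto simp: Q t)
    next
      assume "t = 13" then show ?thesis by (intro power_le_by_list[where ps = "[2, 2, 2, 5, 7, 73]"]) (auto simp: Q t)
    next
      assume "t = 14" then show ?thesis by (intro power_le_by_list[where ps = "[2, 2, 3, 5, 421]"]) (auto simp: Q t)
    next
      assume "t = 15" then show ?thesis by (intro power_le_by_list[where ps = "[2, 2, 2, 2, 2, 2, 13, 37]"]) (auto simp: Q t)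
    next
      assume "t = 16" then show ?thesis by (intro power_le_by_list[where ps = "[2, 2, 5, 17, 109]"]) (auto simp: Q t)
    next
      assume "t = 17" then show ?thesis by (intro power_le_by_list[where ps = "[2, 2, 2, 3, 3, 613]"]) (auto simp: Q t)
    next
      assume "t = 18" then show ?thesis by (intro power_le_by_list[where ps = "[2, 2, 5, 19, 137]"]) (auto simp: Q t)
    next
      assume "t = 19" then show ?thesis by (intro power_le_by_list[where ps = "[2, 2, 2, 2, 5, 761]"]) (auto simp: Q t)
    next
      assume "t = 20" then show ?thesis by (intro power_le_by_list[where ps = "[2, 2, 3, 7, 29, 29]"]) (auto simp: Q t)
    next
      assume "t = 21" then show ?thesis by (intro power_le_by_list[where ps = "[2, 2, 2, 5, 5, 11, 37]"]) (auto simp: Q t)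
    next
      assume "t = 22" then show ?thesis by (intro power_le_by_list[where ps = "[2, 2, 23, 1013]"]) (auto simp: Q t)
    next
      assume "t = 23" then show ?thesis by (intro power_le_by_list[where ps = "[2, 2, 2, 2, 2, 3, 5, 13, 17]"]) (auto simp: Q t)
    next
      assume "t = 24" then show ?thesis by (intro power_le_by_list[where ps = "[2, 2, 5, 5, 1201]"]) (auto simp: Q t)
    next
      assume "t = 25" then show ?thesis by (intro power_le_by_list[where ps = "[2, 2, 2, 13, 1301]"]) (auto simp: Q t)
    next
      assume "t = 26" then show ?thesis by (intro power_le_by_list[where ps = "[2, 2, 3, 3, 3, 5, 281]"]) (auto simp: Q t)
    next
      assume "t = 27" then show ?thesis by (intro power_le_by_list[where ps = "[2, 2, 2, 2, 7, 17, 89]"]) (auto simp: Q t)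
    next
      assume "t = 28" then show ?thesis by (intro power_le_by_list[where ps = "[2, 2, 5, 5, 5, 13, 29]"]) (auto simp: Q t)
    next
      assume "t = 29" then show ?thesis by (intro power_le_by_list[where ps = "[2, 2, 2, 3, 5, 1741]"]) (auto simp: Q t)
    next
      assume "t = 30" then show ?thesis by (intro power_le_by_list[where ps = "[2, 2, 31, 1861]"]) (auto simp: Q t)
    qed
    then show False using less by (simp add: w_def)
  qed
qed

section \<open>Units in difference sets with Singer parameters\<close>

context cyclic_difference_set
begin

text \<open>This is the sieve with \<open>E = {}\<close>. The parameter \<open>t\<close> stands for an approximation of \<open>\<surd>n\<close>: replacing \<open>\<surd>n\<close>
by the tangent bound \<open>(n + t\<^sup>2) / (2 * t)\<close> makes the condition linear in \<open>n\<close>.\<close>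
lemma exists_coprime_by_union_bound:
  assumes "Q > 0" and card_D_eq: "card D = n + 1"
    and \<sigma>: "(\<Sum>l\<in>prime_factors Q. 1 / real l) \<le> \<sigma>" and w: "card (prime_factors Q) = w" and "t > 0" "\<sigma> \<le> real w"
    and less: "\<sigma> * (real n + 1) + (real w - \<sigma>) * ((real n + t\<^sup>2) / (2 * t)) < real n + 1"
  shows "\<exists>i\<in>D. coprime i Q"
proof (rule sieve_criterion[OF \<open>Q > 0\<close>, where E = "{}"])
  let ?s = "sqrt (real n)" and ?\<sigma> = "\<Sum>l\<in>prime_factors Q. 1 / real l"
  have s1: "?s \<le> real n + 1"
  proof (rule real_le_lsqrt)
    show "real n \<le> (real n + 1)\<^sup>2" by (simp add: power2_eq_square algebra_simps)
  qed auto
  have "0 \<le> (?s - t)\<^sup>2" by simp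
  then have "2 * t * ?s \<le> real n + t\<^sup>2" by (simp add: power2_diff mult_ac)
  then have st: "?s \<le> (real n + t\<^sup>2) / (2 * t)" using \<open>t > 0\<close> by (simp add: field_simps)
  have "(\<Sum>l\<in>prime_factors Q. real (card D) / real l + (1 - 1 / real l) * ?s)
      = (\<Sum>l\<in>prime_factors Q. (real n + 1 - ?s) * (1 / real l) + ?s)"
    by (intro sum.cong) (auto simp: card_D_eq algebra_simps add_divide_distrib)
  also have "\<dots> = (real n + 1 - ?s) * ?\<sigma> + real w * ?s"
    using w by (simp add: sum.distrib sum_distrib_left)
  also have "\<dots> \<le> (real n + 1 - ?s) * \<sigma> + real w * ?s"
    using \<sigma> s1 by (intro add_right_mono mult_left_mono) auto
  also have "\<dots> = \<sigma> * (real n + 1) + (real w - \<sigma>) * ?s" by (simp add: algebra_simps)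
  also have "\<dots> \<le> \<sigma> * (real n + 1) + (real w - \<sigma>) * ((real n + t\<^sup>2) / (2 * t))"
    using st \<open>\<sigma> \<le> real w\<close> by (intro add_left_mono mult_left_mono) auto
  also note less
  finally show "(\<Sum>l\<in>prime_factors Q - {}. real (card D) / real l + (1 - 1 / real l) * ?s)
      < (\<Prod>l\<in>{}. 1 - 1 / real l) * (real (card D) - (2 ^ card {} - 1) * ?s)"
    by (simp add: card_D_eq)
qed simp

text \<open>The admissible primes are \<open>3, 7, 13, 19, 31, 37, 43, 61, \<dots>\<close>. With eight or more prime divisors \<open>Q\<close> is so
large that \<open>4^w \<le> n\<close>, where \<open>w\<close> is their number. With fewer, the sum of their reciprocals is at most that
of the first \<open>w\<close> admissible primes, and the product of these primes bounds \<open>n\<close> from below; \<open>t\<close> is chosen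
near the square root of the least \<open>n\<close> that remains. A few small \<open>n\<close> are excluded because \<open>Q\<close> does not
have \<open>w\<close> prime divisors; for \<open>n = 25\<close> the actual primes \<open>3, 7, 31\<close> and \<open>\<surd>n = 5\<close> are used.\<close>
lemma exists_coprime_3:
  assumes Q: "Q = n\<^sup>2 + n + 1" and cD: "card D = n + 1" and n: "n \<ge> 2" "n \<noteq> 4" "n \<noteq> 16"
  shows "\<exists>i\<in>D. coprime i Q"
proof -
  define w where "w = card (prime_factors Q)"
  let ?S = "prime_factors Q"
  have Q0: "Q > 0" by (simp add: Q)
  let ?P = "{3, 7, 13, 19, 31, 37, 43, 61 :: nat}"
  have S: "p \<in> ?P" if "prime p" "p dvd Q" "p < 67" for p
    using prime_dvd_square_add_self_add_one[of p n] primes_below_67[of p] that Q by auto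
  have seg: "\<Prod>T \<le> Q" "(\<Sum>l\<in>?S. 1 / real l) \<le> (\<Sum>l\<in>T. 1 / real l)"
    if T: "T \<subseteq> ?P" "card T = w" "0 < c" "c \<le> 67" "\<forall>p\<in>?P. p < c \<longleftrightarrow> p \<in> T" for T c
  proof -
    have fin: "finite T" using T(1) by (rule finite_subset) simp
    have Tc: "p \<le> c" if "p \<in> T" for p using T that by (meson less_imp_le subsetD)
    have Sc: "p \<in> T" if "prime p" "p dvd Q" "p < c" for p
    proof -
      have "p \<in> ?P" using S that T(4) by simp
      then show ?thesis using T(5) that(3) by blast
    qed
    have "\<Prod>T * c ^ (card ?S - card T) \<le> Q"
      by (rule prod_prime_factors_ge[OF Q0 fin Tc Sc]) (simp_all add: T(2) w_def)
    then show "\<Prod>T \<le> Q" using T(2) by (simp add: w_def)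
    show "(\<Sum>l\<in>?S. 1 / real l) \<le> (\<Sum>l\<in>T. 1 / real l)"
    proof (rule sum_inverse_initial_segment_le[where c = c])
      show "c \<le> p" if "p \<in> ?S - T" for p
      proof (rule ccontr)
        assume "\<not> c \<le> p"
        then have "p \<in> T" using Sc[of p] that by (simp add: in_prime_factors_iff)
        then show False using that by simp
      qed
      show "0 < p \<and> p \<le> c" if "p \<in> T" for p
      proof
        have "p \<in> ?P" using T(1) that by blast
        then show "0 < p" by (elim insertE) simp_all
      qed (rule Tc[OF that])
    qed (use fin T in \<open>simp_all add: w_def\<close>)
  qed
  consider "w \<ge> 8" | "w = 0" | "w = 1" | "w = 2" | "w = 3" | "w = 4" | "w = 5" | "w = 6" | "w = 7" by linarith
  then show ?thesis
  proof cases
    assume "w \<ge> 8"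
    then obtain j where j: "w = 8 + j" using le_Suc_ex by blast
    let ?T = "{3, 7, 13, 19, 31, 37, 43, 61 :: nat}"
    have "\<Prod>?T * 67 ^ (w - card ?T) \<le> Q" unfolding w_def
    proof (rule prod_prime_factors_ge[OF Q0])
      show "p \<in> ?T" if "prime p" "p dvd Q" "p < 67" for p using S that by blast
    qed (use j in \<open>auto simp: w_def\<close>)
    then have Qge: "15605509647 * 67 ^ j \<le> Q" by (simp add: j)
    have "4 ^ w \<le> n"
    proof (rule ccontr)
      assume "\<not> 4 ^ w \<le> n"
      then have less: "n < 4 ^ w" by simp
      have "n + 1 \<le> 2 * n" using n by simp
      also have "\<dots> \<le> n\<^sup>2" using n by (simp add: power2_eq_square)
      finally have "Q \<le> 2 * n\<^sup>2" using Q by simp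
      also have "\<dots> \<le> 2 * (4 ^ w)\<^sup>2" using less by (intro mult_left_mono power_mono) auto
      also have "\<dots> = 8589934592 * 16 ^ j" by (simp add: j power_power_swap[of 4 _ 2] power_add)
      also have "\<dots> \<le> 8589934592 * 67 ^ j" by (intro mult_left_mono power_mono) auto
      finally have "Q \<le> 8589934592 * 67 ^ j" .
      from order_trans[OF Qge this] show False by simp
    qed
    then show ?thesis using exists_coprime_if_power_le[OF Q0] by (simp add: w_def)
  next
    assume "w = 0"
    then have "Q = 1" using Q0 by (simp add: w_def prime_factorization_empty_iff)
    then show ?thesis using Q n by simp
  next
    assume w: "w = 1"
    show ?thesis
      by (rule exists_coprime_by_union_bound[where \<sigma> = "1 / 3" and w = 1 and t = 1])
        (use seg(2)[of "{3}" 7] cD Q0 n w in \<open>auto simp: w_def field_simps\<close>)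
  next
    assume w: "w = 2"
    have "21 \<le> Q" using seg(1)[of "{3, 7}" 13] w by simp
    have "n \<ge> 7"
    proof (rule ccontr)
      assume "\<not> n \<ge> 7"
      then have "n \<in> {2, 3, 5, 6}" using n by auto
      then have "Q \<in> {7, 13, 31, 43}" by (auto simp: Q)
      then have "prime Q" by auto
      then show False using w by (simp add: w_def prime_prime_factors)
    qed
    note le = seg(2)[of "{3, 7}" 13]
    show ?thesis
      by (rule exists_coprime_by_union_bound[where \<sigma> = "10 / 21" and w = 2 and t = "13 / 5"])
        (use le cD Q0 w \<open>n \<ge> 7\<close> in \<open>auto simp: w_def field_simps power2_eq_square\<close>)
  next
    assume w: "w = 3"
    have "273 \<le> Q" using seg(1)[of "{3, 7, 13}" 19] w by simp
    have n16: "n \<ge> 16"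
    proof (rule ccontr)
      assume "\<not> n \<ge> 16"
      then have "n\<^sup>2 \<le> 15\<^sup>2" by (intro power_mono) auto
      then show False using \<open>273 \<le> Q\<close> \<open>\<not> n \<ge> 16\<close> Q by simp
    qed
    show ?thesis
    proof (cases "n \<ge> 29")
      case True
      note le = seg(2)[of "{3, 7, 13}" 19]
      show ?thesis
        by (rule exists_coprime_by_union_bound[where \<sigma> = "151 / 273" and w = 3 and t = "27 / 5"])
          (use le cD Q0 w True in \<open>auto simp: w_def field_simps power2_eq_square\<close>)
    next
      case False
      have few: "n \<noteq> k" if "k\<^sup>2 + k + 1 = prod_list ps" "\<forall>p\<in>set ps. prime p" "card (set ps) < 3" for k ps
        using prime_factors_prod_list[of Q ps] that w by (auto simp: w_def Q)
      have "n \<notin> {17, 18, 19, 20, 21, 22, 23, 24, 26, 27, 28}"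
        using few[of 17 "[307]"] few[of 18 "[7, 7, 7]"] few[of 19 "[3, 127]"] few[of 20 "[421]"]
          few[of 21 "[463]"] few[of 22 "[3, 13, 13]"] few[of 23 "[7, 79]"] few[of 24 "[601]"]
          few[of 26 "[19, 37]"] few[of 27 "[757]"] few[of 28 "[3, 271]"] by auto
      moreover have "n \<in> set [16..<29]" using n16 False by (simp del: upt_rec_numeral)
      then have "n \<in> {16, 17, 18, 19, 20, 21, 22, 23, 24, 25, 26, 27, 28}"
        by (simp add: upt_rec_numeral del: set_upt)
      ultimately have n25: "n = 25" using n(3) by blast
      have pf: "?S = {3, 7, 31}"
        using prime_factors_prod_list[of Q "[3, 7, 31]"] by (auto simp: Q n25)
      have "sqrt (real n) = 5" using n25 by (simp add: real_sqrt_unique)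
      then show ?thesis
        by (intro sieve_criterion[where E = "{}"]) (auto simp: Q0 pf cD n25)
    qed
  next
    assume w: "w = 4"
    have Qge: "5187 \<le> Q" using seg(1)[of "{3, 7, 13, 19}" 31] w by simp
    have "n \<ge> 72"
    proof (rule ccontr)
      assume "\<not> n \<ge> 72"
      then have "n\<^sup>2 \<le> 71\<^sup>2" by (intro power_mono) auto
      then show False using Qge \<open>\<not> n \<ge> 72\<close> Q by simp
    qed
    moreover have "n \<noteq> 72"
    proof
      assume "n = 72"
      then have "?S = {7, 751}" using prime_factors_prod_list[of Q "[7, 751]"] by (auto simp: Q)
      then show False using w by (simp add: w_def)
    qed
    ultimately have "n \<ge> 73" by simp
    note le = seg(2)[of "{3, 7, 13, 19}" 31]
    show ?thesis
      by (rule exists_coprime_by_union_bound[where \<sigma> = "3142 / 5187" and w = 4 and t = "17 / 2"])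
        (use le cD Q0 w \<open>n \<ge> 73\<close> in \<open>auto simp: w_def field_simps power2_eq_square\<close>)
  next
    assume w: "w = 5"
    have Qge: "160797 \<le> Q" using seg(1)[of "{3, 7, 13, 19, 31}" 37] w by simp
    have "n \<ge> 400"
    proof (rule ccontr)
      assume "\<not> n \<ge> 400"
      then have "n\<^sup>2 \<le> 399\<^sup>2" by (intro power_mono) auto
      then show False using Qge \<open>\<not> n \<ge> 400\<close> Q by simp
    qed
    note le = seg(2)[of "{3, 7, 13, 19, 31}" 37]
    show ?thesis
      by (rule exists_coprime_by_union_bound[where \<sigma> = "7 / 10" and w = 5 and t = 20])
        (use le cD Q0 w \<open>n \<ge> 400\<close> in \<open>auto simp: w_def field_simps power2_eq_square\<close>)
  next
    assume w: "w = 6"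
    have Qge: "5949489 \<le> Q" using seg(1)[of "{3, 7, 13, 19, 31, 37}" 43] w by simp
    have "n \<ge> 1000"
    proof (rule ccontr)
      assume "\<not> n \<ge> 1000"
      then have "n\<^sup>2 \<le> 999\<^sup>2" by (intro power_mono) auto
      then show False using Qge \<open>\<not> n \<ge> 1000\<close> Q by simp
    qed
    note le = seg(2)[of "{3, 7, 13, 19, 31, 37}" 43]
    show ?thesis
      by (rule exists_coprime_by_union_bound[where \<sigma> = "7 / 10" and w = 6 and t = 20])
        (use le cD Q0 w \<open>n \<ge> 1000\<close> in \<open>auto simp: w_def field_simps power2_eq_square\<close>)
  next
    assume w: "w = 7"
    have Qge: "255828027 \<le> Q" using seg(1)[of "{3, 7, 13, 19, 31, 37, 43}" 61] w by simp
    have "n \<ge> 1000"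
    proof (rule ccontr)
      assume "\<not> n \<ge> 1000"
      then have "n\<^sup>2 \<le> 999\<^sup>2" by (intro power_mono) auto
      then show False using Qge \<open>\<not> n \<ge> 1000\<close> Q by simp
    qed
    note le = seg(2)[of "{3, 7, 13, 19, 31, 37, 43}" 61]
    show ?thesis
      by (rule exists_coprime_by_union_bound[where \<sigma> = "7 / 10" and w = 7 and t = 20])
        (use le cD Q0 w \<open>n \<ge> 1000\<close> in \<open>auto simp: w_def field_simps power2_eq_square\<close>)
  qed
qed

lemma multiples_of_3_eq:
  "{i\<in>D. 3 dvd i} = {i\<in>D. i mod 3 = 0}"
  by (auto simp: dvd_eq_mod_eq_0)

text \<open>The general bound allows up to eight multiples of \<open>3\<close> in \<open>D\<close>, which is too many for a union bound; there
are exactly three, since \<open>N 0 - N 1 = \<plusminus>4\<close> and \<open>N 0 + 2 * N 1 = 17\<close>.\<close>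
lemma exists_coprime_16_3:
  assumes Q: "Q = 273" and cD: "card D = 17" and n: "n = 16"
    and mult: "\<And>i. i \<in> D \<Longrightarrow> (2 * i) mod Q \<in> D"
  shows "\<exists>i\<in>D. coprime i Q"
proof -
  have pf: "prime_factors Q = {3, 7, 13}"
    using prime_factors_prod_list[of Q "[3, 7, 13]"] by (auto simp: Q)
  have sq: "sqrt (real n) = 4" using n by (simp add: real_sqrt_unique)
  have "coprime 2 Q" by (simp add: Q)
  note N = residue_counts_mod_3[of 2, OF _ _ this mult]
  define N0 N1 where "N0 = card {i\<in>D. i mod 3 = 0}" and "N1 = card {i\<in>D. i mod 3 = 1}"
  have N01: "N0 + 2 * N1 = 17" "(int N0 - int N1)\<^sup>2 = 4\<^sup>2"
    using N Q cD n by (simp_all add: N0_def N1_def)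
  then have "int N0 - int N1 = 4 \<or> int N0 - int N1 = - 4" by (simp only: power2_eq_iff)
  then have "N0 = 3" using N01(1) by presburger
  then have c3: "card {i\<in>D. 3 dvd i} = 3" by (simp add: multiples_of_3_eq N0_def)
  have "real (card {i\<in>D. 7 dvd i}) \<le> 17 / 7 + (1 - 1 / 7) * 4"
    using card_multiples_le[of 7] sq cD Q by simp
  then have c7: "card {i\<in>D. 7 dvd i} \<le> 5" by simp
  have "real (card {i\<in>D. 13 dvd i}) \<le> 17 / 13 + (1 - 1 / 13) * 4"
    using card_multiples_le[of 13] sq cD Q by simp
  then have c13: "card {i\<in>D. 13 dvd i} \<le> 5" by simp
  show ?thesis
    by (rule exists_coprime_if_few_multiples[where E = "{}"]) (use c3 c7 c13 cD in \<open>simp_all add: Q[symmetric] pf, simp add: Q\<close>)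
qed

text \<open>There are at most \<open>18\<close> even elements and exactly \<open>7\<close> multiples of \<open>3\<close> in \<open>D\<close>, so at least \<open>6\<close> elements are
coprime to \<open>6\<close>. At most \<open>4\<close> of them are multiples of \<open>13\<close>, as there are no more such residues modulo
\<open>156\<close> at all.\<close>
lemma exists_coprime_5_4:
  assumes Q: "Q = 156" and cD: "card D = 31" and n: "n = 25"
    and mult: "\<And>i. i \<in> D \<Longrightarrow> (5 * i) mod Q \<in> D"
  shows "\<exists>i\<in>D. coprime i Q"
proof -
  have pf: "prime_factors Q = {2, 3, 13}"
    using prime_factors_prod_list[of Q "[2, 2, 3, 13]"] by (auto simp: Q)
  have sq: "sqrt (real n) = 5" using n by (simp add: real_sqrt_unique)
  have "coprime 5 Q" using prime_imp_coprime[of 5 Q] by (simp add: Q)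
  note N = residue_counts_mod_3[of 5, OF _ _ this mult]
  define N0 N1 where "N0 = card {i\<in>D. i mod 3 = 0}" and "N1 = card {i\<in>D. i mod 3 = 1}"
  have N01: "N0 + 2 * N1 = 31" "(int N0 - int N1)\<^sup>2 = 5\<^sup>2"
    using N Q cD n by (simp_all add: N0_def N1_def)
  then have "int N0 - int N1 = 5 \<or> int N0 - int N1 = - 5" by (simp only: power2_eq_iff)
  then have "N0 = 7" using N01(1) by presburger
  then have c3: "card {i\<in>D. 3 dvd i} = 7" by (simp add: multiples_of_3_eq N0_def)
  have "real (card {i\<in>D. 2 dvd i}) \<le> 31 / 2 + (1 - 1 / 2) * 5"
    using card_multiples_le[of 2] sq cD Q by simp
  then have c2: "card {i\<in>D. 2 dvd i} \<le> 18" by simp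
  have "D = {i\<in>D. 2 dvd i} \<union> ({i\<in>D. 3 dvd i} \<union> {i\<in>D. \<forall>e\<in>{2, 3}. \<not> e dvd i})" by auto
  then have "card D = card ({i\<in>D. 2 dvd i} \<union> ({i\<in>D. 3 dvd i} \<union> {i\<in>D. \<forall>e\<in>{2, 3}. \<not> e dvd i}))"
    by (rule arg_cong)
  also have "\<dots> \<le> card {i\<in>D. 2 dvd i} + card ({i\<in>D. 3 dvd i} \<union> {i\<in>D. \<forall>e\<in>{2, 3}. \<not> e dvd i})"
    by (rule card_Un_le)
  finally have "card D \<le> card {i\<in>D. 2 dvd i} + card ({i\<in>D. 3 dvd i} \<union> {i\<in>D. \<forall>e\<in>{2, 3}. \<not> e dvd i})" .
  moreover have "card ({i\<in>D. 3 dvd i} \<union> {i\<in>D. \<forall>e\<in>{2, 3}. \<not> e dvd i})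
      \<le> card {i\<in>D. 3 dvd i} + card {i\<in>D. \<forall>e\<in>{2, 3}. \<not> e dvd i}" by (rule card_Un_le)
  ultimately have free: "6 \<le> card {i\<in>D. \<forall>e\<in>{2, 3}. \<not> e dvd i}" using c2 c3 cD by linarith
  have "{i\<in>D. (\<forall>e\<in>{2, 3}. \<not> e dvd i) \<and> 13 dvd i} \<subseteq> {13, 65, 91, 143}"
  proof
    fix i assume i: "i \<in> {i\<in>D. (\<forall>e\<in>{2, 3}. \<not> e dvd i) \<and> 13 dvd i}"
    then obtain k where k: "i = 13 * k" by auto
    then have "k < 12" using i D_subset Q by auto
    moreover have "\<not> 2 dvd k" "\<not> 3 dvd k" using i k by auto
    ultimately have "k = 1 \<or> k = 5 \<or> k = 7 \<or> k = 11" by presburger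
    then show "i \<in> {13, 65, 91, 143}" using k by auto
  qed
  then have "card {i\<in>D. (\<forall>e\<in>{2, 3}. \<not> e dvd i) \<and> 13 dvd i} \<le> card {13, 65, 91, 143 :: nat}"
    by (rule card_mono[rotated]) simp
  then have c13: "card {i\<in>D. (\<forall>e\<in>{2, 3}. \<not> e dvd i) \<and> 13 dvd i} \<le> 4" by simp
  have diff: "prime_factors Q - {2, 3} = {13}" by (auto simp: pf)
  show ?thesis
  proof (rule exists_coprime_if_few_multiples[where E = "{2, 3}"])
    show "Q > 0" by (simp add: Q)
    show "(\<Sum>l\<in>prime_factors Q - {2, 3}. card {i\<in>D. (\<forall>e\<in>{2, 3}. \<not> e dvd i) \<and> l dvd i})
        < card {i\<in>D. \<forall>e\<in>{2, 3}. \<not> e dvd i}"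
      unfolding diff using c13 free by simp
  qed
qed

text \<open>With all four primes in \<open>E\<close> the error \<open>15 * 13\<close> exceeds \<open>card D = 183\<close>, and a union bound fails because of
the reciprocals of the small primes.\<close>
lemma exists_coprime_13_4:
  assumes Q: "Q = 2380" and cD: "card D = 183" and n: "n = 169"
  shows "\<exists>i\<in>D. coprime i Q"
proof (rule sieve_criterion[where E = "{2, 5, 7}"])
  have pf: "prime_factors Q = {2, 5, 7, 17}"
    using prime_factors_prod_list[of Q "[2, 2, 5, 7, 17]"] by (auto simp: Q)
  have sq: "sqrt (real n) = 13" using n by (simp add: real_sqrt_unique)
  show "Q > 0" by (simp add: Q)
  show "{2, 5, 7} \<subseteq> prime_factors Q" by (simp add: pf)
  have diff: "prime_factors Q - {2, 5, 7} = {17}" by (auto simp: pf)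
  show "(\<Sum>l\<in>prime_factors Q - {2, 5, 7}. real (card D) / real l + (1 - 1 / real l) * sqrt (real n))
      < (\<Prod>l\<in>{2, 5, 7}. 1 - 1 / real l) * (real (card D) - (2 ^ card {2, 5, 7 :: nat} - 1) * sqrt (real n))"
    unfolding diff by (simp add: sq cD)
qed

end


context cyclic_difference_set
begin

text \<open>The parameters are those of the points of a hyperplane in the projective space of dimension \<open>m - 1\<close>
over the field with \<open>q\<close> elements; \<open>mult\<close> is what remains of the Frobenius automorphism.\<close>
lemma exists_coprime_singer:
  assumes pp: "primepow q" and m: "m > 2" "(q, m) \<noteq> (4, 3)"
    and Q: "Q * (q - 1) = q ^ m - 1" and cD: "card D * (q - 1) = q ^ (m - 1) - 1" and n: "n = q ^ (m - 2)"
    and mult: "\<And>p i. prime p \<Longrightarrow> p dvd q \<Longrightarrow> i \<in> D \<Longrightarrow> (p * i) mod Q \<in> D"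
  shows "\<exists>i\<in>D. coprime i Q"
proof -
  have q2: "q \<ge> 2" using primepow_gt_Suc_0[OF pp] by simp
  have Q0: "Q > 0" using repunit_bounds[OF q2 _ Q] m by simp
  note Qsum = repunit_eq_sum[OF Q q2] and Dsum = repunit_eq_sum[OF cD q2]
  consider "m = 3" | "m = 4" | "m = 5" | "m = 6" | "m \<ge> 7" using m by linarith
  then show ?thesis
  proof cases
    assume m3: "m = 3"
    have Q3: "Q = q\<^sup>2 + q + 1" using Qsum by (simp add: m3 eval_nat_numeral)
    have D3: "card D = q + 1" using Dsum by (simp add: m3 eval_nat_numeral)
    have n3: "n = q" using n m3 by simp
    show ?thesis
    proof (cases "q = 16")
      case True
      then show ?thesis using exists_coprime_16_3 mult[of 2] Q3 D3 n3 by simp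
    next
      case False
      then show ?thesis using exists_coprime_3 Q3 D3 n3 q2 m m3 by simp
    qed
  next
    assume m4: "m = 4"
    have Q4: "Q = (q + 1) * (q\<^sup>2 + 1)" using Qsum by (simp add: m4 eval_nat_numeral algebra_simps)
    have D4: "card D = q\<^sup>2 + q + 1" using Dsum by (simp add: m4 eval_nat_numeral)
    have n4: "n = q\<^sup>2" using n m4 by simp
    consider "q = 5" | "q = 13" | "q \<noteq> 5" "q \<noteq> 13" by blast
    then show ?thesis
    proof cases
      assume "q = 5"
      then show ?thesis using exists_coprime_5_4 mult[of 5] Q4 D4 n4 by simp
    next
      assume "q = 13"
      then show ?thesis using exists_coprime_13_4 Q4 D4 n4 by simp
    next
      assume "q \<noteq> 5" "q \<noteq> 13"
      then have "2 ^ card (prime_factors Q) \<le> q + 2" using omega_bound_4[OF pp _ _ Q4] by simp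
      then have "real (2 ^ card (prime_factors Q)) \<le> real (q + 2)" by (simp only: of_nat_le_iff)
      then have "(2 ^ card (prime_factors Q) - 1) * real q \<le> (real q + 1) * real q"
        by (intro mult_right_mono) auto
      also have "\<dots> < real (card D)" by (simp add: D4 power2_eq_square algebra_simps)
      finally show ?thesis using exists_coprime_if_large[OF Q0] by (simp add: n4)
    qed
  next
    assume "m = 5"
    then show ?thesis using omega_bound_5[OF q2] Q n exists_coprime_if_power_le[OF Q0] by simp
  next
    assume "m = 6"
    then show ?thesis using omega_bound_6[OF q2] Q n exists_coprime_if_power_le[OF Q0] by simp
  next
    assume "m \<ge> 7"
    then show ?thesis using omega_bound_ge_7[OF q2 _ Q] n exists_coprime_if_power_le[OF Q0] by simp
  qed
qed

end

section \<open>Frobenius powers and the dimension of a finite extension\<close>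

text \<open>Pascal's rule splits the sum for \<open>Suc n\<close> into \<open>a\<close> times and \<open>b\<close> times the sum for \<open>n\<close>.\<close>
lemma (in cring) binomial_sum:
  assumes a: "a \<in> carrier R" and b: "b \<in> carrier R"
  shows "(a \<oplus> b) [^] n = (\<Oplus>k\<in>{..n}. add_pow R (n choose k) (a [^] k \<otimes> b [^] (n - k)))"
proof (induction n)
  case 0
  show ?case using a b by simp
next
  case (Suc n)
  define t where "t = (\<lambda>n k. add_pow R (n choose k) (a [^] k \<otimes> b [^] (n - k)))"
  define u where "u = (\<lambda>k. add_pow R (n choose Suc k) (a [^] Suc k \<otimes> b [^] (n - k)))"
  define v where "v = (\<lambda>k. add_pow R (n choose k) (a [^] k \<otimes> b [^] (Suc n - k)))"
  have cl: "t n' k \<in> carrier R" "u k \<in> carrier R" "v k \<in> carrier R" for n' k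
    using a b by (auto simp: t_def u_def v_def)
  have t_Suc: "t (Suc n) (Suc k) = a \<otimes> t n k \<oplus> u k" for k
  proof -
    have "t (Suc n) (Suc k) = add_pow R ((n choose k) + (n choose Suc k)) (a [^] Suc k \<otimes> b [^] (n - k))"
      by (simp add: t_def)
    also have "\<dots> = add_pow R (n choose k) (a [^] Suc k \<otimes> b [^] (n - k)) \<oplus> u k"
      unfolding u_def using a b by (intro add.nat_pow_mult[symmetric]) auto
    also have "add_pow R (n choose k) (a [^] Suc k \<otimes> b [^] (n - k)) = a \<otimes> t n k"
      unfolding t_def using a b by (simp add: add_pow_rdistr m_ac)
    finally show ?thesis .
  qed
  have b_t: "b \<otimes> t n k = v k" if "k \<le> n" for k
    unfolding t_def v_def using a b that by (simp add: add_pow_rdistr Suc_diff_le m_ac)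
  have v_Suc: "v (Suc k) = u k" for k by (simp add: v_def u_def)
  have "finsum R (t (Suc n)) {..Suc n} = finsum R (\<lambda>k. t (Suc n) (Suc k)) {..n} \<oplus> t (Suc n) 0"
    using cl by (intro finsum_Suc2) auto
  also have "finsum R (\<lambda>k. t (Suc n) (Suc k)) {..n} = finsum R (\<lambda>k. a \<otimes> t n k) {..n} \<oplus> finsum R u {..n}"
    unfolding t_Suc using cl a by (intro finsum_addf) auto
  also have "t (Suc n) 0 = v 0" by (simp add: t_def v_def)
  also have "finsum R (\<lambda>k. a \<otimes> t n k) {..n} \<oplus> finsum R u {..n} \<oplus> v 0
    = finsum R (\<lambda>k. a \<otimes> t n k) {..n} \<oplus> (finsum R u {..n} \<oplus> v 0)"
    using cl a by (intro a_assoc finsum_closed) auto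
  also have "finsum R u {..n} \<oplus> v 0 = finsum R v {..Suc n}"
    using finsum_Suc2[of v n] cl by (auto simp: v_Suc)
  also have "finsum R v {..Suc n} = finsum R v {..n}"
    using finsum_Suc[of v n] cl by (auto simp: v_def binomial_eq_0 intro!: r_zero finsum_closed)
  also have "finsum R v {..n} = finsum R (\<lambda>k. b \<otimes> t n k) {..n}"
    using b_t cl b by (intro finsum_cong') auto
  also have "finsum R (\<lambda>k. a \<otimes> t n k) {..n} = a \<otimes> finsum R (t n) {..n}"
    using cl a by (intro finsum_rdistr[symmetric]) auto
  also have "finsum R (\<lambda>k. b \<otimes> t n k) {..n} = b \<otimes> finsum R (t n) {..n}"
    using cl b by (intro finsum_rdistr[symmetric]) auto
  also have "a \<otimes> finsum R (t n) {..n} \<oplus> b \<otimes> finsum R (t n) {..n} = (a \<oplus> b) [^] Suc n"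
    using Suc.IH a b cl by (simp add: t_def l_distr m_comm)
  finally show ?case by (simp add: t_def)
qed

lemma (in cring) frobenius_add:
  assumes p: "prime p" and char: "add_pow R p \<one> = \<zero>"
    and a: "a \<in> carrier R" and b: "b \<in> carrier R"
  shows "(a \<oplus> b) [^] (p :: nat) = a [^] p \<oplus> b [^] p"
proof -
  obtain p' where p': "p = Suc (Suc p')"
    using prime_ge_2_nat[OF p] by (intro that[of "p - 2"]) simp
  have p1: "add_pow R p x = \<zero>" if "x \<in> carrier R" for x
    using add_pow_ldistr[of \<one> x p] char that by simp
  have p0: "add_pow R (p * c) x = \<zero>" if x: "x \<in> carrier R" for c x
    using p1[OF x] add.nat_pow_pow[of x c p] x by (simp add: mult.commute)
  define t where "t = (\<lambda>k. add_pow R (p choose k) (a [^] k \<otimes> b [^] (p - k)))"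
  have cl: "t k \<in> carrier R" for k using a b by (auto simp: t_def)
  have mid: "t (Suc k) = \<zero>" if "k \<le> p'" for k
  proof -
    have "p dvd (p choose Suc k)" using dvd_choose_prime[of "Suc k" p] p that p' by simp
    then obtain c where "p choose Suc k = p * c" ..
    then show ?thesis using p0 a b by (simp add: t_def)
  qed
  have "(a \<oplus> b) [^] p = finsum R t {..Suc (Suc p')}"
    unfolding t_def using binomial_sum[OF a b, of p] p' by simp
  also have "\<dots> = t (Suc (Suc p')) \<oplus> finsum R t {..Suc p'}"
    using cl by (intro finsum_Suc) auto
  also have "finsum R t {..Suc p'} = finsum R (\<lambda>k. t (Suc k)) {..p'} \<oplus> t 0"
    using cl by (intro finsum_Suc2) auto
  also have "finsum R (\<lambda>k. t (Suc k)) {..p'} = finsum R (\<lambda>k. \<zero>) {..p'}"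
    using mid by (intro finsum_cong') auto
  also have "\<dots> = \<zero>" by simp
  finally show ?thesis using a b p' by (simp add: t_def)
qed

lemma (in cring) frobenius_power_add:
  assumes p: "prime p" and char: "add_pow R p \<one> = \<zero>"
    and a: "a \<in> carrier R" and b: "b \<in> carrier R"
  shows "(a \<oplus> b) [^] ((p :: nat) ^ k) = a [^] (p ^ k) \<oplus> b [^] (p ^ k)"
proof (induction k)
  case 0
  show ?case using a b by simp
next
  case (Suc k)
  have "(a \<oplus> b) [^] (p ^ Suc k) = ((a \<oplus> b) [^] (p ^ k)) [^] p"
    using a b by (simp add: nat_pow_pow mult.commute)
  also have "\<dots> = (a [^] (p ^ k)) [^] p \<oplus> (b [^] (p ^ k)) [^] p"
    unfolding Suc using a b by (intro frobenius_add[OF p char]) auto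
  also have "\<dots> = a [^] (p ^ Suc k) \<oplus> b [^] (p ^ Suc k)"
    using a b by (simp add: nat_pow_pow mult.commute)
  finally show ?case .
qed

text \<open>Lagrange's theorem in the additive group gives \<open>p ^ k \<cdot> 1 = 0\<close>, and this is the \<open>k\<close>-th power of
\<open>p \<cdot> 1\<close>.\<close>
lemma (in field) characteristic_of_prime_power_card:
  assumes p: "prime p" and "finite (carrier R)" and card: "card (carrier R) = p ^ k"
  shows "add_pow R p \<one> = \<zero>"
proof -
  have "add_pow R (p ^ k) \<one> = \<zero>"
    using add.pow_order_eq_1[of \<one>] card by (simp add: order_def)
  moreover have "add_pow R (p ^ j) \<one> = (add_pow R p \<one>) [^] j" for j
  proof (induction j)
    case 0
    show ?case by simp
  next
    case (Suc j)
    have "add_pow R (p ^ Suc j) \<one> = add_pow R p (add_pow R (p ^ j) \<one>)"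
      by (simp add: add.nat_pow_pow mult.commute)
    also have "\<dots> = add_pow R (p ^ j) \<one> \<otimes> add_pow R p \<one>"
      by (simp add: add_pow_rdistr)
    finally show ?case using Suc by simp
  qed
  ultimately have "(add_pow R p \<one>) [^] k = \<zero>" by simp
  then show ?thesis
  proof (induction k)
    case (Suc k)
    then show ?case by (auto simp: integral_iff)
  qed simp
qed

text \<open>Coordinates with respect to a basis are unique, so \<open>E\<close> has as many elements as there are coordinate
lists of length \<open>n\<close> over \<open>K\<close>.\<close>
lemma (in ring) card_of_dimension:
  assumes K: "subfield K R" and "finite K" and dim: "dimension n K E"
  shows "card E = card K ^ n"
proof -
  obtain Us where Us: "set Us \<subseteq> carrier R" "independent K Us" "length Us = n" "Span K Us = E"
    using exists_base[OF K dim] by blast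
  let ?L = "{Ks. set Ks \<subseteq> K \<and> length Ks = length Us}"
  have span: "Span K Us = (\<lambda>Ks. combine Ks Us) ` ?L"
    using Span_eq_combine_set_length_version[OF K Us(1)] by auto
  have "inj_on (\<lambda>Ks. combine Ks Us) ?L"
  proof (rule inj_onI)
    fix Ks Ls assume Ks: "Ks \<in> ?L" and Ls: "Ls \<in> ?L" and eq: "combine Ks Us = combine Ls Us"
    from Ks have "combine Ks Us \<in> Span K Us" using span by blast
    from unique_decomposition[OF K Us(2) this] show "Ks = Ls" using Ks Ls eq by auto
  qed
  then have "card ((\<lambda>Ks. combine Ks Us) ` ?L) = card ?L" by (rule card_image)
  then have "card E = card ?L" unfolding span[symmetric] Us(4) .
  then show ?thesis using Us(3) card_lists_length_eq[OF \<open>finite K\<close>, of n] by simp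
qed

section \<open>The trace of a finite field extension\<close>

locale finite_field_extension = field F for F :: "('a, 'b) ring_scheme" (structure) +
  fixes K :: "'a set" and q m :: nat
  assumes primepow_q: "primepow q" and m_gt_1: "m > 1"
    and finite_F: "finite (carrier F)" and card_F: "card (carrier F) = q ^ m"
    and subfield_K: "subfield K F" and card_K: "card K = q"
begin

lemma q_gt_1: "q > 1"
  using primepow_gt_Suc_0[OF primepow_q] by simp

lemma K_subset: "K \<subseteq> carrier F"
  using subfieldE(3)[OF subfield_K] .

lemma finite_K: "finite K"
  using finite_subset[OF K_subset finite_F] .

lemma dim_eq: "ring.dim F K (carrier F) = m"
proof -
  obtain xs where xs: "set xs = carrier F" using finite_list[OF finite_F] by blast
  have "carrier F \<subseteq> Span K xs" using Span_base_incl[OF subfield_K, of xs] xs by simp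
  moreover have "Span K xs \<subseteq> carrier F" using Span_in_carrier[OF K_subset, of xs] xs by simp
  ultimately have "Span K xs = carrier F" by blast
  then have "finite_dimension K (carrier F)"
    using Span_finite_dimension[OF subfield_K, of xs] xs by simp
  then have "dimension (dim K (carrier F)) K (carrier F)"
    using finite_dimensionE[OF subfield_K] by (simp add: over_def)
  then have "q ^ m = q ^ dim K (carrier F)"
    using card_of_dimension[OF subfield_K finite_K] card_F card_K by simp
  then show ?thesis using q_gt_1 power_inject_exp by metis
qed

definition tr :: "'a \<Rightarrow> 'a" where
  "tr x = (\<Oplus>i\<in>{..<m}. x [^] (q ^ i))"

lemma finite_field_trace_eq: "finite_field_trace F K x = tr x"
  by (simp add: finite_field_trace_def tr_def dim_eq card_K)

lemma tr_closed [simp]: "x \<in> carrier F \<Longrightarrow> tr x \<in> carrier F"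
  unfolding tr_def by (intro finsum_closed) auto

lemma prime_of_q:
  assumes "prime p" "p dvd q"
  obtains a where "a > 0" "q = p ^ a" "add_pow F p \<one> = \<zero>"
proof -
  from primepow_q obtain r a where r: "prime r" "a > 0" "q = r ^ a" by (auto simp: primepow_def)
  with assms have "p = r" by (metis prime_dvd_power primes_dvd_imp_eq)
  moreover have "add_pow F r \<one> = \<zero>"
    using characteristic_of_prime_power_card[OF r(1) finite_F, of "a * m"] card_F r by (simp add: power_mult)
  ultimately show ?thesis using that r by simp
qed

lemma q_power_add:
  assumes "x \<in> carrier F" "y \<in> carrier F"
  shows "(x \<oplus> y) [^] (q ^ i) = x [^] (q ^ i) \<oplus> y [^] (q ^ i)"
proof -
  obtain p where "prime p" "p dvd q" using q_gt_1 prime_factor_nat[of q] by auto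
  then obtain a where "q = p ^ a" "add_pow F p \<one> = \<zero>" by (rule prime_of_q)
  then show ?thesis using frobenius_power_add[OF \<open>prime p\<close> _ assms, of "a * i"] by (simp add: power_mult)
qed

lemma tr_add: "x \<in> carrier F \<Longrightarrow> y \<in> carrier F \<Longrightarrow> tr (x \<oplus> y) = tr x \<oplus> tr y"
  unfolding tr_def q_power_add by (intro finsum_addf) auto

lemma power_card_F: assumes "x \<in> carrier F" "x \<noteq> \<zero>" shows "x [^] (q ^ m - 1) = \<one>"
proof -
  interpret G: group "mult_of F" by (rule field_mult_group)
  show ?thesis using G.pow_order_eq_1[of x] assms order_mult_of[OF finite_F] card_F
    by (simp add: order_def nat_pow_mult_of)
qed

lemma power_q_iff: 
  assumes "x \<in> carrier F"
  shows "x [^] q = x \<longleftrightarrow> x = \<zero> \<or> x [^] (q - 1) = \<one>"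
proof -
  have "x [^] q = x [^] (q - 1) \<otimes> x" using q_gt_1 assms by (metis Suc_diff_1 less_trans nat_pow_Suc zero_less_one)
  then show ?thesis using assms by auto (metis l_one m_rcancel nat_pow_closed one_closed)
qed

text \<open>Lagrange's theorem in the multiplicative group of \<open>K\<close> gives one inclusion. The other follows by counting, since
\<open>x^(q-1) = 1\<close> has at most \<open>q - 1\<close> solutions.\<close>
lemma K_eq: "K = {x \<in> carrier F. x [^] q = x}"
proof (rule card_seteq)
  show "finite {x \<in> carrier F. x [^] q = x}" using finite_F by simp
  show "K \<subseteq> {x \<in> carrier F. x [^] q = x}"
  proof
    fix x assume x: "x \<in> K"
    show "x \<in> {x \<in> carrier F. x [^] q = x}"
    proof (cases "x = \<zero>")
      case True then show ?thesis using q_gt_1 by (simp add: nat_pow_zero)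
    next
      case False
      let ?H = "mult_of F\<lparr>carrier := K - {\<zero>}\<rparr>"
      interpret H: group ?H
        by (rule subgroup.subgroup_is_group[OF subgroup_mult_of[OF subfield_K] field_mult_group])
      have "order ?H = q - 1"
        using card_K finite_K subringE(2)[OF subfieldE(1)[OF subfield_K]] by (simp add: order_def)
      then have "x [^]\<^bsub>?H\<^esub> (q - 1) = \<one>" using H.pow_order_eq_1[of x] x False by simp
      then have "x [^] (q - 1) = \<one>"
        by (simp add: nat_pow_def)
      then show ?thesis using power_q_iff x K_subset by auto
    qed
  qed
  have "{x \<in> carrier F. x [^] q = x} \<subseteq> insert \<zero> {x \<in> carrier F. x [^] (q - 1) = \<one>}"
    using power_q_iff by auto
  then have "card {x \<in> carrier F. x [^] q = x} \<le> card (insert \<zero> {x \<in> carrier F. x [^] (q - 1) = \<one>})"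
    using finite_F by (intro card_mono) auto
  also have "\<dots> \<le> Suc (q - 1)"
    using num_roots_le_deg[OF finite_F, of "q - 1"] q_gt_1 finite_F by (auto simp: card_insert_if)
  finally show "card {x \<in> carrier F. x [^] q = x} \<le> card K" using q_gt_1 card_K by simp
qed

lemma K_power: assumes "a \<in> K" shows "a [^] (q ^ i) = a"
proof (induction i)
  case 0 then show ?case using assms K_subset by auto
next
  case (Suc i)
  have "a [^] (q ^ Suc i) = (a [^] (q ^ i)) [^] q"
    using assms K_subset by (simp add: nat_pow_pow mult.commute subset_iff)
  then show ?case using Suc assms K_eq by simp
qed

lemma tr_smult: assumes "a \<in> K" "x \<in> carrier F" shows "tr (a \<otimes> x) = a \<otimes> tr x"
proof -
  have a: "a \<in> carrier F" using assms K_subset by auto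
  have "tr (a \<otimes> x) = (\<Oplus>i\<in>{..<m}. a \<otimes> x [^] (q ^ i))"
    unfolding tr_def using assms a by (simp add: nat_pow_distrib K_power)
  also have "\<dots> = a \<otimes> tr x" unfolding tr_def using assms a by (intro finsum_rdistr[symmetric]) auto
  finally show ?thesis .
qed

lemma tr_power_p:
  assumes p: "prime p" "p dvd q" and x: "x \<in> carrier F"
  shows "tr (x [^] p) = tr x [^] p"
proof -
  obtain a where "q = p ^ a" and char: "add_pow F p \<one> = \<zero>" using prime_of_q[OF p] .
  have "finsum F f A [^] p = (\<Oplus>i\<in>A. f i [^] p)" if "finite A" "f \<in> A \<rightarrow> carrier F" for f :: "nat \<Rightarrow> 'a" and A
    using that
  proof (induction A)
    case empty
    then show ?case using prime_gt_0_nat[OF p(1)] by (simp add: nat_pow_zero)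
  next
    case (insert i A)
    then show ?case by (simp add: Pi_def frobenius_add[OF p(1) char])
  qed
  from this[of "{..<m}" "\<lambda>i. x [^] (q ^ i)"] show ?thesis
    unfolding tr_def using x by (simp add: nat_pow_pow mult.commute)
qed

lemma tr_zero [simp]: "tr \<zero> = \<zero>"
proof -
  have "tr \<zero> = tr (\<zero> \<otimes> \<zero>)" by simp
  also have "\<dots> = \<zero> \<otimes> tr \<zero>"
    using subringE(2)[OF subfieldE(1)[OF subfield_K]] by (intro tr_smult) auto
  finally show ?thesis by simp
qed

lemma tr_minus: assumes "x \<in> carrier F" "y \<in> carrier F" shows "tr (x \<ominus> y) = tr x \<ominus> tr y"
proof -
  have "tr x = tr ((x \<ominus> y) \<oplus> y)" using assms by (simp add: minus_eq a_assoc l_neg)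
  also have "\<dots> = tr (x \<ominus> y) \<oplus> tr y" using assms by (intro tr_add) auto
  finally show ?thesis using assms by (simp add: minus_eq a_assoc r_neg)
qed

lemma power_q_finsum:
  assumes "finite A" "f \<in> A \<rightarrow> carrier F"
  shows "finsum F f A [^] q = (\<Oplus>i\<in>A. f i [^] q)"
  using assms
proof (induction A)
  case empty
  then show ?case using q_gt_1 by (simp add: nat_pow_zero)
next
  case (insert i A)
  then show ?case using q_power_add[of _ _ 1] by (simp add: Pi_def)
qed

lemma power_q_m: assumes "x \<in> carrier F" shows "x [^] (q ^ m) = x"
proof (cases "x = \<zero>")
  case True
  then show ?thesis using q_gt_1 by (simp add: nat_pow_zero)
next
  case False
  have "x [^] (q ^ m) = x [^] Suc (q ^ m - 1)" using q_gt_1 by simp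
  also have "\<dots> = x [^] (q ^ m - 1) \<otimes> x" by simp
  finally show ?thesis using power_card_F[OF assms False] assms by simp
qed

text \<open>Raising to the power \<open>q\<close> permutes the summands of the trace cyclically.\<close>
lemma tr_in_K: assumes x: "x \<in> carrier F" shows "tr x \<in> K"
proof -
  obtain k where k: "m = Suc k" using m_gt_1 by (cases m) auto
  define f where "f = (\<lambda>i. x [^] (q ^ i))"
  have cl: "f i \<in> carrier F" for i using x by (simp add: f_def)
  have "{..<m} = {..k}" using k by auto
  then have tr: "tr x = finsum F f {..k}" by (simp add: tr_def f_def)
  have "tr x [^] q = (\<Oplus>i\<in>{..k}. f i [^] q)" unfolding tr using cl by (intro power_q_finsum) auto
  also have "\<dots> = (\<Oplus>i\<in>{..k}. f (Suc i))"
    using x by (simp add: f_def nat_pow_pow mult.commute)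
  finally have "tr x [^] q \<oplus> f 0 = finsum F f {..Suc k}" using finsum_Suc2[of f k] cl by auto
  also have "\<dots> = f (Suc k) \<oplus> tr x" using finsum_Suc[of f k] cl tr by auto
  also have "f (Suc k) = f 0" using power_q_m[OF x] x by (simp add: f_def k)
  also have "f 0 \<oplus> tr x = tr x \<oplus> f 0" using x cl by (intro a_comm) auto
  finally have "tr x [^] q = tr x" using x cl by (simp add: add.right_cancel)
  then show ?thesis using x K_eq by auto
qed

text \<open>The trace is a polynomial function of degree \<open>q^(m-1)\<close>, less than the number of elements of \<open>F\<close>.\<close>
lemma tr_nonzero: "\<exists>x\<in>carrier F. tr x \<noteq> \<zero>"
proof -
  interpret U: UP_domain F "UP F" by unfold_locales
  have "\<exists>f\<in>carrier (UP F). (\<forall>x\<in>carrier F. eval F F id x f = (\<Oplus>i\<in>{..n}. x [^] (q ^ i))) \<and> deg F f = q ^ n" for n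
  proof (induction n)
    case 0
    show ?case
    proof (intro bexI[of _ "monom (UP F) \<one> 1"] conjI ballI)
      fix x assume "x \<in> carrier F"
      then show "eval F F id x (monom (UP F) \<one> 1) = (\<Oplus>i\<in>{..0}. x [^] (q ^ i))"
        using U.evalRR_monom[of \<one> x 1] by simp
    qed (auto simp: U.deg_monom)
  next
    case (Suc n)
    then obtain f where f: "f \<in> carrier (UP F)" "deg F f = q ^ n"
      "\<And>x. x \<in> carrier F \<Longrightarrow> eval F F id x f = (\<Oplus>i\<in>{..n}. x [^] (q ^ i))" by blast
    let ?g = "monom (UP F) \<one> (q ^ Suc n) \<oplus>\<^bsub>UP F\<^esub> f"
    have d: "deg F (monom (UP F) \<one> (q ^ Suc n)) = q ^ Suc n" by (simp add: U.deg_monom)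
    have lt: "q ^ n < q ^ Suc n" using q_gt_1 by simp
    have "deg F ?g = q ^ Suc n"
      using U.deg_add_eq[of "monom (UP F) \<one> (q ^ Suc n)" f] f d lt by simp
    moreover have "eval F F id x ?g = (\<Oplus>i\<in>{..Suc n}. x [^] (q ^ i))" if "x \<in> carrier F" for x
    proof -
      have "eval F F id x ?g = eval F F id x (monom (UP F) \<one> (q ^ Suc n)) \<oplus> eval F F id x f"
        using f that by (intro U.evalRR_add) auto
      also have "\<dots> = x [^] (q ^ Suc n) \<oplus> (\<Oplus>i\<in>{..n}. x [^] (q ^ i))"
        using f that by (simp add: U.evalRR_monom)
      finally show ?thesis using that by (simp add: Pi_def)
    qed
    moreover have "?g \<in> carrier (UP F)" using f by simp
    ultimately show ?case by blast
  qed
  from this[of "m - 1"] obtain f where f: "f \<in> carrier (UP F)" "deg F f = q ^ (m - 1)"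
    "\<And>x. x \<in> carrier F \<Longrightarrow> eval F F id x f = (\<Oplus>i\<in>{..m-1}. x [^] (q ^ i))" by blast
  have "{..m-1} = {..<m}" using m_gt_1 by auto
  then have ev: "eval F F id x f = tr x" if "x \<in> carrier F" for x using f(3)[OF that] by (simp add: tr_def)
  have "f \<noteq> \<zero>\<^bsub>UP F\<^esub>" using f q_gt_1 by (intro U.deg_nzero_nzero) auto
  then have "card {a \<in> carrier F. eval F F id a f = \<zero>} \<le> q ^ (m - 1)"
    using U.roots_bound[OF f(1) _ finite_F] f(2) by auto
  moreover have "{a \<in> carrier F. eval F F id a f = \<zero>} = {a \<in> carrier F. tr a = \<zero>}" using ev by auto
  moreover have "q ^ (m - 1) < q ^ m" using q_gt_1 m_gt_1 by (intro power_strict_increasing) auto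
  ultimately have "{a \<in> carrier F. tr a = \<zero>} \<noteq> carrier F" using card_F by auto
  then show ?thesis by auto
qed

text \<open>On the \<open>K\<close>-subspace \<open>V\<close> the functional \<open>x \<mapsto> tr (c \<otimes> x)\<close> takes the value \<open>1\<close> at some \<open>w\<close>, and
\<open>V\<close> is the direct sum of its kernel and of the line spanned by \<open>w\<close>.\<close>
lemma card_kernel:
  assumes V: "V \<subseteq> carrier F" "\<And>x y. x \<in> V \<Longrightarrow> y \<in> V \<Longrightarrow> x \<oplus> y \<in> V" "\<And>a x. a \<in> K \<Longrightarrow> x \<in> V \<Longrightarrow> a \<otimes> x \<in> V"
    and c: "c \<in> carrier F" and v: "v \<in> V" "tr (c \<otimes> v) \<noteq> \<zero>"
  shows "card V = q * card {x\<in>V. tr (c \<otimes> x) = \<zero>}"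
proof -
  note Kr = subringE[OF subfieldE(1)[OF subfield_K]]
  let ?W = "{x\<in>V. tr (c \<otimes> x) = \<zero>}"
  have vF: "v \<in> carrier F" using v V by auto
  define s where "s = inv (tr (c \<otimes> v))"
  have sK: "s \<in> K" unfolding s_def
    using subfield_m_inv(1)[OF subfield_K, of "tr (c \<otimes> v)"] v tr_in_K[of "c \<otimes> v"] vF c by auto
  have sF: "s \<in> carrier F" using sK K_subset by auto
  define w where "w = s \<otimes> v"
  have w: "w \<in> V" "w \<in> carrier F" using V sK sF v vF by (auto simp: w_def)
  have "tr (c \<otimes> w) = tr (s \<otimes> (c \<otimes> v))" using c vF sF by (simp add: w_def m_lcomm)
  also have "\<dots> = s \<otimes> tr (c \<otimes> v)" using sK c vF by (intro tr_smult) auto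
  also have "\<dots> = \<one>" unfolding s_def using v vF c by (intro Units_l_inv) (auto simp: field_Units)
  finally have tw: "tr (c \<otimes> w) = \<one>" .
  have tlin: "tr (c \<otimes> (x \<oplus> a \<otimes> w)) = tr (c \<otimes> x) \<oplus> a" if "x \<in> carrier F" "a \<in> K" for x a
  proof -
    have aF: "a \<in> carrier F" using that K_subset by auto
    have "c \<otimes> (x \<oplus> a \<otimes> w) = c \<otimes> x \<oplus> a \<otimes> (c \<otimes> w)" using that c w aF by (simp add: r_distr m_lcomm)
    then have "tr (c \<otimes> (x \<oplus> a \<otimes> w)) = tr (c \<otimes> x) \<oplus> tr (a \<otimes> (c \<otimes> w))" using that c w aF by (simp add: tr_add)
    also have "tr (a \<otimes> (c \<otimes> w)) = a" using tr_smult[of a "c \<otimes> w"] that c w tw aF by simp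
    finally show ?thesis .
  qed
  have "bij_betw (\<lambda>(a, x). x \<oplus> a \<otimes> w) (K \<times> ?W) V"
  proof (rule bij_betwI[where g = "\<lambda>y. (tr (c \<otimes> y), y \<oplus> (\<ominus> tr (c \<otimes> y)) \<otimes> w)"])
    show "(\<lambda>(a, x). x \<oplus> a \<otimes> w) \<in> K \<times> ?W \<rightarrow> V" using V w by auto
    show "(\<lambda>y. (tr (c \<otimes> y), y \<oplus> (\<ominus> tr (c \<otimes> y)) \<otimes> w)) \<in> V \<rightarrow> K \<times> ?W"
    proof
      fix y assume y: "y \<in> V"
      then have yF: "y \<in> carrier F" using V by auto
      have tK: "tr (c \<otimes> y) \<in> K" "\<ominus> tr (c \<otimes> y) \<in> K" using yF c tr_in_K Kr(5) by auto
      then have "tr (c \<otimes> (y \<oplus> (\<ominus> tr (c \<otimes> y)) \<otimes> w)) = \<zero>" using tlin[OF yF tK(2)] yF c by (simp add: r_neg)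
      then show "(tr (c \<otimes> y), y \<oplus> (\<ominus> tr (c \<otimes> y)) \<otimes> w) \<in> K \<times> ?W" using tK V y w by auto
    qed
  next
    fix z assume z: "z \<in> K \<times> ?W"
    obtain a x where ax: "z = (a, x)" "a \<in> K" "x \<in> V" "tr (c \<otimes> x) = \<zero>" using z by auto
    then have F: "a \<in> carrier F" "x \<in> carrier F" using K_subset V by auto
    then have 1: "tr (c \<otimes> (x \<oplus> a \<otimes> w)) = a" using tlin[OF F(2) ax(2)] ax by simp
    have "x \<oplus> a \<otimes> w \<oplus> (\<ominus> a) \<otimes> w = x" using F w by (simp add: a_assoc l_minus r_neg)
    then show "(\<lambda>y. (tr (c \<otimes> y), y \<oplus> (\<ominus> tr (c \<otimes> y)) \<otimes> w)) ((\<lambda>(a, x). x \<oplus> a \<otimes> w) z) = z"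
      using 1 ax by simp
  next
    fix y assume y: "y \<in> V"
    then have "y \<in> carrier F" using V by auto
    then show "(\<lambda>(a, x). x \<oplus> a \<otimes> w) (tr (c \<otimes> y), y \<oplus> (\<ominus> tr (c \<otimes> y)) \<otimes> w) = y"
      using w c by (simp add: a_assoc l_minus l_neg)
  qed
  then have "card (K \<times> ?W) = card V" by (rule bij_betw_same_card)
  then show ?thesis using card_K by (simp add: card_cartesian_product)
qed

lemma card_tr_kernel: "card {x\<in>carrier F. tr x = \<zero>} = q ^ (m - 1)"
proof -
  obtain v where v: "v \<in> carrier F" "tr v \<noteq> \<zero>" using tr_nonzero by blast
  have "card (carrier F) = q * card {x\<in>carrier F. tr (\<one> \<otimes> x) = \<zero>}"
    by (rule card_kernel[where v = v]) (use v K_subset in auto)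
  moreover have "{x\<in>carrier F. tr (\<one> \<otimes> x) = \<zero>} = {x\<in>carrier F. tr x = \<zero>}" by auto
  moreover have "q ^ m = q * q ^ (m - 1)" using m_gt_1 by (cases m) auto
  ultimately show ?thesis using card_F q_gt_1 by simp
qed

text \<open>If \<open>x \<mapsto> tr (c \<otimes> x)\<close> vanished on the kernel of the trace, it would be a multiple \<open>a\<close> of the trace with
\<open>a \<in> K\<close>. Then \<open>x \<mapsto> tr ((c - a) \<otimes> x)\<close> would be zero, and \<open>c = a\<close> would lie in \<open>K\<close>. So the functional
cuts the kernel down by a factor \<open>q\<close>.\<close>
lemma card_tr_kernel_pair:
  assumes c: "c \<in> carrier F" "c \<notin> K"
  shows "card {x\<in>carrier F. tr x = \<zero> \<and> tr (c \<otimes> x) = \<zero>} = q ^ (m - 2)"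
proof -
  let ?V = "{x\<in>carrier F. tr x = \<zero>}"
  note Kr = subringE[OF subfieldE(1)[OF subfield_K]]
  obtain v where v: "v \<in> carrier F" "tr v \<noteq> \<zero>" using tr_nonzero by blast
  have "\<exists>v\<in>?V. tr (c \<otimes> v) \<noteq> \<zero>"
  proof (rule ccontr)
    assume "\<not> ?thesis"
    then have no: "tr (c \<otimes> x) = \<zero>" if "x \<in> carrier F" "tr x = \<zero>" for x using that by auto
    have invK: "inv (tr v) \<in> K" using subfield_m_inv(1)[OF subfield_K, of "tr v"] v tr_in_K by auto
    then have invF: "inv (tr v) \<in> carrier F" using K_subset by auto
    have invv: "inv (tr v) \<otimes> tr v = \<one>" using v by (intro Units_l_inv) (auto simp: field_Units)
    define a where "a = tr (c \<otimes> v) \<otimes> inv (tr v)"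
    have aK: "a \<in> K" unfolding a_def using invK tr_in_K v c Kr(6) by auto
    then have aF: "a \<in> carrier F" using K_subset by auto
    have proportional: "tr (c \<otimes> y) = a \<otimes> tr y" if y: "y \<in> carrier F" for y
    proof -
      let ?b = "tr y \<otimes> inv (tr v)"
      have bK: "?b \<in> K" using invK tr_in_K y Kr(6) by auto
      then have bF: "?b \<in> carrier F" using K_subset by auto
      have "tr (y \<ominus> ?b \<otimes> v) = tr y \<ominus> ?b \<otimes> tr v" using y v bF bK by (simp add: tr_minus tr_smult)
      also have "\<dots> = \<zero>" using y v invF invv by (simp add: m_assoc)
      finally have "\<zero> = tr (c \<otimes> (y \<ominus> ?b \<otimes> v))" using no y v bF by auto
      also have "c \<otimes> (y \<ominus> ?b \<otimes> v) = c \<otimes> y \<ominus> ?b \<otimes> (c \<otimes> v)"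
        using y v bF c by (simp add: minus_eq r_distr r_minus m_lcomm)
      also have "tr \<dots> = tr (c \<otimes> y) \<ominus> ?b \<otimes> tr (c \<otimes> v)"
        using y v bF bK c tr_smult[of ?b "c \<otimes> v"] by (simp add: tr_minus)
      finally have "tr (c \<otimes> y) = ?b \<otimes> tr (c \<otimes> v)" using y v c bF by (metis m_closed r_right_minus_eq tr_closed)
      also have "\<dots> = a \<otimes> tr y" unfolding a_def using y v c invF by (simp add: m_ac)
      finally show ?thesis .
    qed
    define d where "d = c \<ominus> a"
    have d: "d \<in> carrier F" "d \<noteq> \<zero>" using c aF aK by (auto simp: d_def)
    have "tr (d \<otimes> y) = \<zero>" if y: "y \<in> carrier F" for y
    proof -
      have "d \<otimes> y = c \<otimes> y \<ominus> a \<otimes> y" using y c aF by (simp add: d_def minus_eq l_distr l_minus)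
      then have "tr (d \<otimes> y) = tr (c \<otimes> y) \<ominus> a \<otimes> tr y" using y c aF aK by (simp add: tr_minus tr_smult)
      then show ?thesis using proportional[OF y] y aF by simp
    qed
    from this[of "inv d \<otimes> v"] have "tr (d \<otimes> (inv d \<otimes> v)) = \<zero>" using d v by (simp add: field_Units)
    moreover have "d \<otimes> (inv d \<otimes> v) = v" using d v by (simp add: m_assoc[symmetric] field_Units)
    ultimately show False using v by simp
  qed
  then obtain w where w: "w \<in> ?V" "tr (c \<otimes> w) \<noteq> \<zero>" by blast
  have "card ?V = q * card {x\<in>?V. tr (c \<otimes> x) = \<zero>}"
    by (rule card_kernel[where v = w]) (use w c K_subset in \<open>auto simp: tr_add tr_smult\<close>)
  moreover have "{x\<in>?V. tr (c \<otimes> x) = \<zero>} = {x\<in>carrier F. tr x = \<zero> \<and> tr (c \<otimes> x) = \<zero>}" by auto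
  moreover have "q ^ (m - 1) = q * q ^ (m - 2)"
    using m_gt_1 by (metis Suc_1 Suc_diff_Suc power_Suc)
  ultimately show ?thesis using card_tr_kernel q_gt_1 by simp
qed

end

section \<open>Discrete logarithms of the trace-zero elements\<close>

lemma prime_factors_nat_radical: 
  assumes "n > 0" shows "prime_factors (nat_radical n) = prime_factors n"
proof -
  have nz: "nat_radical n \<noteq> 0" by (auto simp: nat_radical_def)
  have "p dvd nat_radical n \<longleftrightarrow> p \<in> prime_factors n" if p: "prime p" for p
  proof
    assume "p dvd nat_radical n"
    then obtain r where "r \<in> prime_factors n" "p dvd r"
      unfolding nat_radical_def using prime_dvd_prod_iff[of "prime_factors n" p "\<lambda>x. x"] p by auto
    then show "p \<in> prime_factors n" using p primes_dvd_imp_eq[of p r] by auto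
  qed (auto simp: nat_radical_def intro: dvd_prodI[of _ _ "\<lambda>x. x", simplified])
  then show ?thesis using nz assms by (auto simp: in_prime_factors_iff)
qed

text \<open>A prime dividing both \<open>L\<close> and \<open>M div L\<close> could be multiplied into \<open>L\<close> without changing the radical,
contradicting maximality. Hence \<open>L\<close> contains the full \<open>p\<close>-part of \<open>M\<close> for each prime \<open>p\<close> dividing \<open>Q\<close>.\<close>
lemma largest_divisor_same_radical_props:
  assumes "M > 0" "Q dvd M"
  defines "L \<equiv> largest_divisor_same_radical M Q"
  shows "L dvd M" "prime_factors L = prime_factors Q" "coprime L (M div L)" "Q dvd L"
proof -
  let ?S = "{d. d dvd M \<and> nat_radical d = nat_radical Q}"
  have Q: "Q > 0" using assms by (auto intro: dvd_pos_nat)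
  have fin: "finite ?S" using finite_subset[of ?S "{d. d dvd M}"] \<open>M > 0\<close> by auto
  have "Q \<in> ?S" using assms by auto
  then have L: "L \<in> ?S" unfolding L_def largest_divisor_same_radical_def
    using Max_in[OF fin] by blast
  have max: "d \<le> L" if "d \<in> ?S" for d
    unfolding L_def largest_divisor_same_radical_def using Max_ge[OF fin that] .
  show LM: "L dvd M" using L by simp
  then have L0: "L > 0" using \<open>M > 0\<close> by (auto intro: dvd_pos_nat)
  show pf: "prime_factors L = prime_factors Q"
    using prime_factors_nat_radical[OF L0] prime_factors_nat_radical[OF Q] L by simp
  show cop: "coprime L (M div L)"
  proof (rule ccontr)
    assume "\<not> coprime L (M div L)"
    then obtain p where p: "prime p" "p dvd L" "p dvd M div L"
      using prime_factor_nat[of "gcd L (M div L)"] by (auto simp: coprime_iff_gcd_eq_1)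
    have "p * L dvd M" using p(3) LM by (metis dvd_mult_div_cancel mult.commute mult_dvd_mono dvd_refl)
    moreover have "prime_factors (p * L) = prime_factors L"
      using p L0 prime_gt_0_nat[OF p(1)]
      by (auto simp: prime_factors_product prime_prime_factors in_prime_factors_iff)
    then have "nat_radical (p * L) = nat_radical Q" using L by (simp add: nat_radical_def)
    ultimately have "p * L \<le> L" using max by auto
    then show False using L0 prime_gt_1_nat[OF p(1)] by simp
  qed
  have "coprime Q (M div L)"
  proof (rule ccontr)
    assume "\<not> coprime Q (M div L)"
    then obtain p where p: "prime p" "p dvd Q" "p dvd M div L"
      using prime_factor_nat[of "gcd Q (M div L)"] by (auto simp: coprime_iff_gcd_eq_1)
    then have "p \<in> prime_factors L" using pf Q by (simp add: in_prime_factors_iff)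
    then have "p dvd L" by auto
    then show False using p cop not_coprimeI[of p L "M div L"] not_prime_unit by blast
  qed
  moreover have "Q dvd L * (M div L)" using LM assms(2) by simp
  ultimately show "Q dvd L" using coprime_dvd_mult_left_iff by blast
qed

lemma pred_dvd_power_pred: "(q - 1) dvd (q ^ m - 1 :: nat)"
proof (cases "q = 0")
  case True then show ?thesis by (cases m) auto
next
  case False
  then have "[q ^ m = 1 ^ m] (mod (q - 1))" by (intro cong_pow) (simp add: cong_altdef_nat)
  then show ?thesis using False by (simp add: cong_altdef_nat)
qed

locale finite_field_generator = finite_field_extension +
  fixes g :: 'a
  assumes g_nonzero: "g \<in> carrier F - {\<zero>}"
    and generates: "carrier F - {\<zero>} = range (\<lambda>i::nat. g [^] i)"
begin

definition Q where "Q = (q ^ m - 1) div (q - 1)"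

lemma Q_mult: "Q * (q - 1) = q ^ m - 1"
  unfolding Q_def using pred_dvd_power_pred by simp

lemma qm_gt: "q ^ m - 1 > 0"
  using one_less_power[of q m] q_gt_1 m_gt_1 by simp

lemma Q_pos: "Q > 0"
  using Q_mult qm_gt by (cases "Q = 0") auto

lemma g_pow [simp]: "g [^] (i::nat) \<in> carrier F" "g [^] (i::nat) \<noteq> \<zero>"
  using generates by auto

lemma card_mult_group: "card (carrier F - {\<zero>}) = q ^ m - 1"
  using card_F finite_F by simp

lemma ord_g: "group.ord (mult_of F) g = q ^ m - 1"
proof -
  interpret G: group "mult_of F" by (rule field_mult_group)
  have "card (carrier F - {\<zero>}) \<le> G.ord g"
  proof -
    have gG: "g \<in> carrier (mult_of F)" and finG: "finite (carrier (mult_of F))"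
      using g_nonzero finite_F by auto
    have "carrier F - {\<zero>} = (\<lambda>x. g [^] x) ` {0 .. G.ord g - 1}"
      using G.ord_elems[OF finG gG] generates by (simp only: Setcompr_eq_image nat_pow_mult_of)
    then have "card (carrier F - {\<zero>}) \<le> card {0 .. G.ord g - 1}"
      using card_image_le[of "{0 .. G.ord g - 1}" "\<lambda>x. g [^] x"] by simp
    then show ?thesis using G.ord_ge_1[OF finG gG] by simp
  qed
  moreover have "G.ord g dvd q ^ m - 1"
    using G.ord_dvd_group_order[of g] g_nonzero card_mult_group by (simp add: order_def)
  then have "G.ord g \<le> q ^ m - 1" using dvd_imp_le qm_gt by blast
  ultimately show ?thesis using card_mult_group by simp
qed

lemma g_pow_eq_one_iff: "g [^] n = \<one> \<longleftrightarrow> (q ^ m - 1) dvd n"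
proof -
  interpret G: group "mult_of F" by (rule field_mult_group)
  show ?thesis using G.pow_eq_id[of g n] g_nonzero ord_g by (simp add: nat_pow_mult_of)
qed

lemma g_pow_inj: "inj_on (\<lambda>j. g [^] j) {..<q ^ m - 1}"
proof -
  interpret G: group "mult_of F" by (rule field_mult_group)
  have "{..<q ^ m - 1} = {0..G.ord g - 1}" using ord_g qm_gt by auto
  then show ?thesis using G.ord_inj[of g] g_nonzero by (simp add: nat_pow_mult_of)
qed

lemma g_pow_mod: "g [^] (j mod (q ^ m - 1)) = g [^] j"
proof -
  have "g [^] j = g [^] ((q ^ m - 1) * (j div (q ^ m - 1)) + j mod (q ^ m - 1))" by simp
  also have "\<dots> = g [^] ((q ^ m - 1) * (j div (q ^ m - 1))) \<otimes> g [^] (j mod (q ^ m - 1))"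
    using g_nonzero by (intro nat_pow_mult[symmetric]) auto
  also have "g [^] ((q ^ m - 1) * (j div (q ^ m - 1))) = \<one>"
    by (subst g_pow_eq_one_iff) simp
  finally show ?thesis by simp
qed

text \<open>The elements of \<open>K\<close> are the roots of \<open>x^q = x\<close>, and \<open>g\<close> has order \<open>Q * (q - 1)\<close>.\<close>
lemma g_pow_in_K_iff: "g [^] t \<in> K \<longleftrightarrow> Q dvd t"
proof -
  have "g [^] t \<in> K \<longleftrightarrow> (g [^] t) [^] (q - 1) = \<one>"
    using power_q_iff[of "g [^] t"] by (simp add: K_eq)
  also have "\<dots> \<longleftrightarrow> Q * (q - 1) dvd t * (q - 1)"
    unfolding Q_mult g_pow_eq_one_iff[symmetric] using g_nonzero by (simp add: nat_pow_pow)
  also have "\<dots> \<longleftrightarrow> Q dvd t" using q_gt_1 by simp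
  finally show ?thesis .
qed

text \<open>These are the unions of punctured lines through the origin, that is, the subsets of projective space.\<close>
definition scalar_invariant :: "'a set \<Rightarrow> bool" where
  "scalar_invariant P \<longleftrightarrow> P \<subseteq> carrier F - {\<zero>} \<and> (\<forall>x\<in>carrier F. \<forall>a\<in>K - {\<zero>}. a \<otimes> x \<in> P \<longleftrightarrow> x \<in> P)"

lemma scalar_invariant_mod:
  assumes "scalar_invariant P" shows "g [^] j \<in> P \<longleftrightarrow> g [^] (j mod Q) \<in> P"
proof -
  have "g [^] j = g [^] (Q * (j div Q) + j mod Q)" by simp
  also have "\<dots> = g [^] (Q * (j div Q)) \<otimes> g [^] (j mod Q)"
    using g_nonzero by (intro nat_pow_mult[symmetric]) auto
  finally have "g [^] j = g [^] (Q * (j div Q)) \<otimes> g [^] (j mod Q)" .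
  moreover have "g [^] (Q * (j div Q)) \<in> K - {\<zero>}" using g_pow_in_K_iff by auto
  ultimately show ?thesis using assms unfolding scalar_invariant_def by simp
qed

text \<open>Each exponent below \<open>q^m - 1\<close> is uniquely \<open>i + Q * s\<close> with \<open>i < Q\<close> and \<open>s < q - 1\<close>, and adding \<open>Q * s\<close> to an
exponent multiplies the power of \<open>g\<close> by a scalar.\<close>
lemma card_scalar_invariant:
  assumes P: "scalar_invariant P"
  shows "card P = card {i\<in>{..<Q}. g [^] i \<in> P} * (q - 1)"
proof -
  let ?J = "{j\<in>{..<q ^ m - 1}. g [^] j \<in> P}" and ?I = "{i\<in>{..<Q}. g [^] i \<in> P}"
  have "P = (\<lambda>j. g [^] j) ` ?J"
  proof
    show "P \<subseteq> (\<lambda>j. g [^] j) ` ?J"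
    proof
      fix x assume x: "x \<in> P"
      then obtain j :: nat where j: "x = g [^] j" using P generates by (auto simp: scalar_invariant_def)
      then have "x = g [^] (j mod (q ^ m - 1))" by (simp only: g_pow_mod)
      then show "x \<in> (\<lambda>j. g [^] j) ` ?J" using x qm_gt by auto
    qed
  qed auto
  then have "card P = card ?J"
    using card_image[of "\<lambda>j. g [^] j" ?J] inj_on_subset[OF g_pow_inj, of ?J] by auto
  also have "\<dots> = card (?I \<times> {..<q - 1})"
  proof (rule bij_betw_same_card[symmetric, where f = "\<lambda>(i, s). i + Q * s"], rule bij_betwI[where g = "\<lambda>j. (j mod Q, j div Q)"])
    show "(\<lambda>(i, s). i + Q * s) \<in> ?I \<times> {..<q - 1} \<rightarrow> ?J"
    proof clarify
      fix i s assume i: "i < Q" "g [^] i \<in> P" and s: "s < q - 1"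
      have "i + Q * s < Q * Suc s" using i by simp
      also have "\<dots> \<le> Q * (q - 1)" using s by (intro mult_le_mono) auto
      finally have "i + Q * s < q ^ m - 1" using Q_mult by simp
      moreover have "g [^] (i + Q * s) \<in> P" using scalar_invariant_mod[OF P, of "i + Q * s"] i by simp
      ultimately show "i + Q * s \<in> {..<q ^ m - 1} \<and> g [^] (i + Q * s) \<in> P" by simp
    qed
    show "(\<lambda>j. (j mod Q, j div Q)) \<in> ?J \<rightarrow> ?I \<times> {..<q - 1}"
      using scalar_invariant_mod[OF P] Q_pos Q_mult by (auto simp: less_mult_imp_div_less mult.commute)
  qed (use Q_pos in auto)
  finally show ?thesis by (simp add: card_cartesian_product)
qed

definition D where "D = {i\<in>{..<Q}. tr (g [^] i) = \<zero>}"

lemma tr_smult_eq_zero_iff: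
  assumes "a \<in> K - {\<zero>}" "x \<in> carrier F" shows "tr (a \<otimes> x) = \<zero> \<longleftrightarrow> tr x = \<zero>"
proof -
  have "a \<in> carrier F" "a \<noteq> \<zero>" using assms K_subset by auto
  moreover have "tr (a \<otimes> x) = a \<otimes> tr x" using assms by (intro tr_smult) auto
  ultimately show ?thesis using assms by (simp add: integral_iff)
qed

lemma scalar_invariant_kernel_pair:
  assumes c: "c \<in> carrier F"
  shows "scalar_invariant {x\<in>carrier F - {\<zero>}. tr x = \<zero> \<and> tr (c \<otimes> x) = \<zero>}"
  unfolding scalar_invariant_def
proof (intro conjI ballI)
  fix x a assume x: "x \<in> carrier F" and a: "a \<in> K - {\<zero>}"
  have aF: "a \<in> carrier F" using a K_subset by auto
  have "c \<otimes> (a \<otimes> x) = a \<otimes> (c \<otimes> x)" using c x aF by (simp add: m_lcomm)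
  then show "a \<otimes> x \<in> {x\<in>carrier F - {\<zero>}. tr x = \<zero> \<and> tr (c \<otimes> x) = \<zero>}
      \<longleftrightarrow> x \<in> {x\<in>carrier F - {\<zero>}. tr x = \<zero> \<and> tr (c \<otimes> x) = \<zero>}"
    using x aF a c by (auto simp: tr_smult_eq_zero_iff integral_iff)
qed auto

lemma scalar_invariant_kernel: "scalar_invariant {x\<in>carrier F - {\<zero>}. tr x = \<zero>}"
  using scalar_invariant_kernel_pair[of \<one>] by (simp add: conj_assoc cong: conj_cong)

lemma D_mod: "tr (g [^] j) = \<zero> \<longleftrightarrow> j mod Q \<in> D"
  using scalar_invariant_mod[OF scalar_invariant_kernel, of j] Q_pos by (simp add: D_def)

lemma card_D_mult: "card D * (q - 1) = q ^ (m - 1) - 1"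
proof -
  have "D = {i\<in>{..<Q}. g [^] i \<in> {x\<in>carrier F - {\<zero>}. tr x = \<zero>}}" by (auto simp: D_def)
  then have "card D * (q - 1) = card {x\<in>carrier F - {\<zero>}. tr x = \<zero>}"
    using card_scalar_invariant[OF scalar_invariant_kernel] by simp
  also have "{x\<in>carrier F - {\<zero>}. tr x = \<zero>} = {x\<in>carrier F. tr x = \<zero>} - {\<zero>}" by auto
  also have "card \<dots> = q ^ (m - 1) - 1" using card_tr_kernel finite_F by (subst card_Diff_singleton) auto
  finally show ?thesis .
qed

text \<open>For \<open>0 < t < Q\<close> the element \<open>g^t\<close> is not a scalar, so the two conditions of trace zero for \<open>x\<close> and for
\<open>g^t \<otimes> x\<close> are independent.\<close>
lemma card_shift_D:
  assumes "0 < t" "t < Q"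
  shows "card {i\<in>D. (i + t) mod Q \<in> D} * (q - 1) = q ^ (m - 2) - 1"
proof -
  have tK: "g [^] t \<notin> K" using g_pow_in_K_iff assms by (auto dest: dvd_imp_le)
  let ?P = "{x\<in>carrier F - {\<zero>}. tr x = \<zero> \<and> tr (g [^] t \<otimes> x) = \<zero>}"
  have "g [^] t \<otimes> g [^] i = g [^] (i + t)" for i
    using g_nonzero by (simp add: nat_pow_mult add.commute)
  then have "{i\<in>D. (i + t) mod Q \<in> D} = {i\<in>{..<Q}. g [^] i \<in> ?P}"
    by (auto simp: D_mod) (auto simp: D_def)
  then have "card {i\<in>D. (i + t) mod Q \<in> D} * (q - 1) = card ?P"
    using card_scalar_invariant[OF scalar_invariant_kernel_pair, of "g [^] t"] by simp
  also have "?P = {x\<in>carrier F. tr x = \<zero> \<and> tr (g [^] t \<otimes> x) = \<zero>} - {\<zero>}" by auto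
  also have "card \<dots> = q ^ (m - 2) - 1"
    using card_tr_kernel_pair[OF _ tK] finite_F by (subst card_Diff_singleton) auto
  finally show ?thesis .
qed

text \<open>The parameter \<open>lam\<close> is the number of points of a subspace of codimension two, and the size of \<open>D\<close> that of
a hyperplane; their difference is \<open>q^(m-2)\<close>.\<close>
lemma difference_set: "cyclic_difference_set Q ((q ^ (m - 2) - 1) div (q - 1)) (q ^ (m - 2)) D"
proof
  let ?l = "(q ^ (m - 2) - 1) div (q - 1)"
  have l: "?l * (q - 1) = q ^ (m - 2) - 1" using pred_dvd_power_pred by simp
  show "D \<subseteq> {..<Q}" by (auto simp: D_def)
  show "card {i\<in>D. (i + t) mod Q \<in> D} = ?l" if "0 < t" "t < Q" for t
    using card_shift_D[OF that, symmetric] q_gt_1 by simp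
  have "(?l + q ^ (m - 2)) * (q - 1) = q ^ (m - 2) - 1 + q ^ (m - 2) * (q - 1)"
    using l by (simp add: add_mult_distrib)
  also have "\<dots> = q ^ (m - 1) - 1"
  proof -
    have "m - 1 = Suc (m - 2)" using m_gt_1 by simp
    then have "q ^ (m - 1) = q ^ (m - 2) * q" by simp
    moreover have "q ^ (m - 2) \<ge> 1" using q_gt_1 by simp
    ultimately show ?thesis using q_gt_1 by (simp add: diff_mult_distrib2)
  qed
  finally show "card D = ?l + q ^ (m - 2)"
    using card_D_mult q_gt_1 mult_right_cancel[of "q - 1" "card D" "?l + q ^ (m - 2)"] by simp
qed

text \<open>The trace commutes with the Frobenius automorphism \<open>x \<mapsto> x^p\<close>.\<close>
lemma D_multiplier:
  assumes "prime p" "p dvd q" "i \<in> D" shows "(p * i) mod Q \<in> D"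
proof -
  have "g [^] (p * i) = (g [^] i) [^] p" using g_nonzero by (simp add: nat_pow_pow mult.commute)
  then have "tr (g [^] (p * i)) = \<zero> [^] p" using assms tr_power_p[OF assms(1,2)] by (simp add: D_def)
  then show ?thesis using D_mod prime_gt_0_nat[OF assms(1)] by (simp add: nat_pow_zero)
qed

lemma ord_g_pow: "group.ord (mult_of F) (g [^] j) = (q ^ m - 1) div gcd (q ^ m - 1) j"
proof -
  interpret G: group "mult_of F" by (rule field_mult_group)
  show ?thesis using G.ord_pow_gen[of g j] g_nonzero ord_g qm_gt by (simp add: nat_pow_mult_of)
qed

text \<open>Put \<open>M = q^m - 1\<close> and \<open>L\<close> the prescribed divisor of \<open>N\<close>. As \<open>L\<close> and \<open>M div L\<close> are coprime, there is an
exponent \<open>j\<close> congruent to \<open>i\<close> modulo \<open>L\<close> and to \<open>M div N\<close> modulo \<open>M div L\<close>. The first congruence keeps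
the trace zero because \<open>Q\<close> divides \<open>L\<close>, and makes \<open>j\<close> coprime to \<open>L\<close>; so the greatest common divisor of
\<open>M\<close> and \<open>j\<close> is \<open>M div N\<close>.\<close>
lemma exists_order_of_coprime:
  assumes i: "i \<in> D" "coprime i Q" and N: "N dvd q ^ m - 1"
    and L: "largest_divisor_same_radical (q ^ m - 1) Q dvd N"
  shows "\<exists>x\<in>carrier (mult_of F). group.ord (mult_of F) x = N \<and> tr x = \<zero>"
proof -
  define M where "M = q ^ m - 1"
  define L where "L = largest_divisor_same_radical M Q"
  have QM: "Q dvd M" unfolding M_def Q_mult[symmetric] by simp
  have M0: "M > 0" using qm_gt by (simp add: M_def)
  note LP = largest_divisor_same_radical_props[OF M0 QM, folded L_def]
  have L0: "L > 0" using LP(1) M0 by (auto intro: dvd_pos_nat)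
  have N': "N dvd M" "L dvd N" using N L by (auto simp: M_def L_def)
  have N0: "N > 0" using N'(1) M0 by (auto intro: dvd_pos_nat)
  obtain j where j: "[j = i] (mod L)" "[j = M div N] (mod (M div L))"
    using binary_chinese_remainder_nat[OF LP(3)] by blast
  obtain a where a: "N = L * a" using N'(2) ..
  obtain b where b: "M = N * b" using N'(1) ..
  have b0: "b > 0" using b M0 by (cases b) auto
  have MN: "M div N = b" using b N0 by simp
  have MdL: "M div L = a * b" using a b L0 by (simp add: mult.assoc)
  have "coprime i L"
  proof (rule ccontr)
    assume "\<not> coprime i L"
    then obtain p where p: "prime p" "p dvd i" "p dvd L"
      using prime_factor_nat[of "gcd i L"] by (auto simp: coprime_iff_gcd_eq_1)
    then have "p \<in> prime_factors L" using L0 by (simp add: in_prime_factors_iff)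
    then have "p \<in> prime_factors Q" using LP(2) by simp
    then have "p dvd Q" by auto
    then show False using p i(2) not_coprimeI[of p i Q] not_prime_unit by blast
  qed
  then have "coprime j L" using cong_imp_coprime cong_sym[OF j(1)] by blast
  then have "gcd M j = gcd (a * b) j"
    using gcd_mult_left_left_cancel[of j L "a * b"] a b by (simp add: mult.assoc)
  also have "\<dots> = gcd (a * b) b" using cong_gcd_eq[OF j(2)] by (simp add: MN MdL gcd.commute)
  also have "\<dots> = b" by simp
  finally have "M div gcd M j = N" using b b0 by simp
  then have "group.ord (mult_of F) (g [^] j) = N" using ord_g_pow by (simp add: M_def)
  moreover have "j mod Q = i"
    using cong_dvd_modulus_nat[OF j(1) LP(4)] i(1) by (simp add: cong_def D_def)
  then have "tr (g [^] j) = \<zero>" using D_mod i by simp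
  ultimately show ?thesis by (intro bexI[of _ "g [^] j"]) auto
qed

end

context finite_field_extension
begin

lemma exists_generator:
  obtains g where "finite_field_generator F K q m g"
proof -
  obtain a where a: "a \<in> carrier (mult_of F)" "carrier (mult_of F) = {a [^] i | i::nat. i \<in> UNIV}"
    using finite_field_mult_group_has_gen[OF finite_F] by blast
  have "finite_field_generator F K q m a"
    by unfold_locales (use a in auto)
  then show ?thesis by (rule that)
qed

end

section \<open>The two exceptional families\<close>

context finite_field_extension
begin

lemma ord_dvd_of_power_eq_one:
  assumes "x \<in> carrier F - {\<zero>}" "x [^] (k::nat) = \<one>"
  shows "group.ord (mult_of F) x dvd k"
proof -
  interpret G: group "mult_of F" by (rule field_mult_group)
  show ?thesis using G.pow_eq_id[of x k] assms by (simp add: nat_pow_mult_of)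
qed

text \<open>From \<open>x^q = -x\<close> the order of \<open>x\<close> divides \<open>2 * (q - 1)\<close>. If \<open>q + 1\<close> divides this order then it divides
\<open>4\<close>, so \<open>q = 3\<close>; but then the order is at most \<open>4\<close> and should be a multiple of \<open>8\<close>.\<close>
lemma no_trace_zero_generator_quadratic:
  assumes m: "m = 2" and x: "x \<in> carrier F - {\<zero>}" "tr x = \<zero>"
    and L: "largest_divisor_same_radical (q ^ m - 1) (q + 1) dvd group.ord (mult_of F) x"
  shows False
proof -
  obtain r where r: "q = Suc r" "r > 0" using q_gt_1 by (cases q) auto
  have M: "q ^ m - 1 = (q + 1) * (q - 1)" by (simp add: m r power2_eq_square algebra_simps)
  have M0: "q ^ m - 1 > 0" unfolding M using r by simp
  have QM: "q + 1 dvd q ^ m - 1" unfolding M by (rule dvd_triv_left)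
  note LP = largest_divisor_same_radical_props[OF M0 QM]
  have xF: "x \<in> carrier F" using x by simp
  have "{..<m} = {0, 1}" using m by auto
  then have "tr x = x \<oplus> x [^] q" using xF unfolding tr_def by simp
  then have "x [^] q = \<ominus> x" using x xF by (metis add.inv_equality a_comm nat_pow_closed)
  then have "(x [^] q) [^] (2::nat) = x [^] (2::nat)" using xF by (simp add: numeral_2_eq_2 l_minus r_minus)
  then have eq: "x [^] (2 * q) = x [^] (2::nat)" using xF by (simp add: nat_pow_pow mult.commute)
  have "x [^] (2 * (q - 1)) \<otimes> x [^] (2::nat) = x [^] (2 * q)"
    using xF r by (simp add: nat_pow_mult)
  then have "x [^] (2 * (q - 1)) \<otimes> x [^] (2::nat) = \<one> \<otimes> x [^] (2::nat)" using eq xF by simp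
  moreover have "x [^] (2::nat) \<noteq> \<zero>" using x by (simp add: numeral_2_eq_2 integral_iff)
  ultimately have "x [^] (2 * (q - 1)) = \<one>" using xF m_rcancel by blast
  then have ord: "group.ord (mult_of F) x dvd 2 * (q - 1)" by (rule ord_dvd_of_power_eq_one[OF x(1)])
  have "q + 1 dvd 2 * (q - 1)" using LP(4) L ord dvd_trans by blast
  then have "q + 1 dvd 2 * (q + 1) - 2 * (q - 1)" by (intro dvd_diff_nat dvd_triv_right)
  moreover have "2 * (q + 1) - 2 * (q - 1) = 4" using r by simp
  ultimately have "q + 1 dvd 4" by simp
  then have "q + 1 \<le> 4" by (rule dvd_imp_le) simp
  then have "q = 2 \<or> q = 3" using q_gt_1 by auto
  then have q3: "q = 3" using \<open>q + 1 dvd 4\<close> by (elim disjE) simp_all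
  define L where "L = largest_divisor_same_radical 8 4"
  have L8: "L dvd 8" "prime_factors L = prime_factors 4" "coprime L (8 div L)" "L dvd 4"
    using LP L ord dvd_trans by (auto simp: q3 m L_def)
  have "prime_factors (4 :: nat) = {2}" using prime_factors_prod_list[of 4 "[2, 2]"] by simp
  then have "2 dvd L" using L8(2) by auto
  have "L \<le> 4" using L8(4) by (rule dvd_imp_le) simp
  then have "L = 0 \<or> L = 1 \<or> L = 2 \<or> L = 3 \<or> L = 4" by linarith
  then show False using \<open>2 dvd L\<close> L8(1,3) by (elim disjE) auto
qed

text \<open>Dividing the trace \<open>x + x^4 + x^16\<close> by \<open>x\<close> gives \<open>1 + y + y^5\<close> with \<open>y = x^3\<close>. In characteristic two
this factors, and a root of the first factor has \<open>y^3 = 1\<close>. For a root of the second,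
\<open>y^7 = y\<^sup>2 y^5 = y\<^sup>2 (y + 1) = y^3 + y\<^sup>2 = 1\<close>.\<close>
lemma no_trace_zero_generator_64_over_4:
  assumes q: "q = 4" and m: "m = 3" and x: "x \<in> carrier F - {\<zero>}" "tr x = \<zero>"
    and L: "largest_divisor_same_radical 63 21 dvd group.ord (mult_of F) x"
  shows False
proof -
  have xF: "x \<in> carrier F" "x \<noteq> \<zero>" using x by auto
  have L63: "largest_divisor_same_radical 63 21 = 63"
  proof -
    define L where "L = largest_divisor_same_radical 63 21"
    note LP = largest_divisor_same_radical_props[of 63 21, folded L_def]
    have "21 dvd L" using LP(4) by simp
    then obtain k where k: "L = 21 * k" ..
    have "L dvd 63" using LP(1) by simp
    then have "21 * k dvd 21 * 3" using k by simp
    then have "k dvd 3" by (subst (asm) dvd_times_left_cancel_iff) auto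
    then have "k = 1 \<or> k = 3" using prime_nat_iff[of 3] by auto
    moreover have "\<not> coprime (21 :: nat) 3" using coprime_common_divisor[of "21 :: nat" 3 3] by auto
    then have "k \<noteq> 1" using LP(3) k by auto
    ultimately show ?thesis using k by (simp add: L_def)
  qed
  have "(2 :: nat) dvd q" by (simp add: q)
  then have "add_pow F (2 :: nat) \<one> = \<zero>" by (rule prime_of_q[OF two_is_prime_nat])
  then have "\<one> \<oplus> \<one> = \<zero>" by (simp add: numeral_2_eq_2 add.nat_pow_Suc)
  then have two: "z \<oplus> z = \<zero>" if "z \<in> carrier F" for z
    using l_distr[of \<one> \<one> z] that by simp
  have eqI: "a = b" if "a \<oplus> b = \<zero>" "a \<in> carrier F" "b \<in> carrier F" for a b
  proof -
    have "a \<oplus> b = b \<oplus> b" unfolding that(1) two[OF that(3)] ..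
    then show "a = b" unfolding add.right_cancel[OF that(3,2,3)] .
  qed
  define y where "y = x [^] (3::nat)"
  have y: "y \<in> carrier F" using xF by (simp add: y_def)
  define y2 y3 y5 where "y2 = y \<otimes> y" and "y3 = y \<otimes> (y \<otimes> y)" and "y5 = y \<otimes> (y \<otimes> (y \<otimes> (y \<otimes> y)))"
  note ys = y2_def y3_def y5_def
  define y4 where "y4 = y2 \<otimes> y2"
  have cl: "y2 \<in> carrier F" "y3 \<in> carrier F" "y4 \<in> carrier F" "y5 \<in> carrier F"
    using y by (auto simp: ys y4_def)
  have "{..<m} = {0, 1, 2}" using m by auto
  then have tr: "tr x = x \<oplus> (x [^] (4::nat) \<oplus> x [^] (16::nat))" using xF q unfolding tr_def by simp
  have x4: "x [^] (4::nat) = x \<otimes> y" using xF nat_pow_mult[of x 1 3] by (simp add: y_def)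
  have "y [^] (5::nat) = y5"
    using y by (simp add: ys eval_nat_numeral m_ac)
  then have x16: "x [^] (16::nat) = x \<otimes> y5"
    using xF nat_pow_mult[of x 1 15] nat_pow_pow[of x 3 5] by (simp add: y_def)
  have "x \<otimes> (\<one> \<oplus> (y \<oplus> y5)) = tr x"
    unfolding tr x4 x16 using xF y cl by (simp add: r_distr)
  then have "x \<otimes> (\<one> \<oplus> (y \<oplus> y5)) = \<zero>" using x by simp
  then have trinomial: "\<one> \<oplus> (y \<oplus> y5) = \<zero>" using xF y cl by (simp add: integral_iff)
  have mult: "y2 \<otimes> y3 = y5" "y2 \<otimes> y2 = y4" "y \<otimes> y3 = y4" "y \<otimes> y2 = y3"
    using y by (simp_all add: ys y4_def m_assoc)
  have "(y2 \<oplus> (y \<oplus> \<one>)) \<otimes> (y3 \<oplus> (y2 \<oplus> \<one>))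
      = (y5 \<oplus> (y4 \<oplus> y3)) \<oplus> ((y4 \<oplus> (y3 \<oplus> y2)) \<oplus> (y2 \<oplus> (y \<oplus> \<one>)))"
    using y cl by (simp add: l_distr r_distr mult)
  also have "\<dots> = (\<one> \<oplus> (y \<oplus> y5)) \<oplus> ((y4 \<oplus> y4) \<oplus> ((y2 \<oplus> y2) \<oplus> (y3 \<oplus> y3)))"
    using y cl by (simp add: a_ac)
  also have "\<dots> = \<zero>" using trinomial two cl by simp
  finally have "y2 \<oplus> (y \<oplus> \<one>) = \<zero> \<or> y3 \<oplus> (y2 \<oplus> \<one>) = \<zero>" using y cl by (simp add: integral_iff)
  then have "x [^] (9::nat) = \<one> \<or> x [^] (21::nat) = \<one>"
  proof
    assume A: "y2 \<oplus> (y \<oplus> \<one>) = \<zero>"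
    have "y \<otimes> (y2 \<oplus> (y \<oplus> \<one>)) = y3 \<oplus> (y2 \<oplus> y)"
      using y cl by (simp add: r_distr mult y2_def[symmetric])
    then have "y3 \<oplus> (y2 \<oplus> y) = \<zero>" using A y by simp
    then have "y3 = y2 \<oplus> y" by (rule eqI) (use y cl in simp_all)
    also have "(y2 \<oplus> y) \<oplus> \<one> = \<zero>" using A y cl by (simp add: a_assoc)
    then have "y2 \<oplus> y = \<one>" by (rule eqI) (use y cl in simp_all)
    finally have "y3 = \<one>" .
    moreover have "y [^] (3::nat) = y3" using y by (simp add: ys eval_nat_numeral m_ac)
    ultimately show ?thesis using xF nat_pow_pow[of x 3 3] by (simp add: y_def)
  next
    assume A: "y3 \<oplus> (y2 \<oplus> \<one>) = \<zero>"
    have "y5 \<oplus> (y \<oplus> \<one>) = \<zero>" using trinomial y cl by (simp add: a_ac)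
    then have "y5 = y \<oplus> \<one>" by (rule eqI) (use y cl in simp_all)
    then have "y2 \<otimes> y5 = y3 \<oplus> y2" using y cl by (simp add: r_distr mult m_comm[of y2 y])
    also have "(y3 \<oplus> y2) \<oplus> \<one> = \<zero>" using A cl by (simp add: a_assoc)
    then have "y3 \<oplus> y2 = \<one>" by (rule eqI) (use cl in simp_all)
    finally have "y2 \<otimes> y5 = \<one>" .
    moreover have "y [^] (7::nat) = y2 \<otimes> y5" using y by (simp add: ys eval_nat_numeral m_ac)
    ultimately show ?thesis using xF nat_pow_pow[of x 3 7] by (simp add: y_def)
  qed
  then have "63 dvd (9::nat) \<or> 63 dvd (21::nat)"
    using ord_dvd_of_power_eq_one[OF x(1)] L unfolding L63 using dvd_trans by blast
  then show False by simp
qed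

end

section \<open>Orders of trace-zero elements\<close>

theorem theorem6p4:
  fixes F :: "('a, 'b) ring_scheme" and K :: "'a set" and q m Q N :: nat
  assumes "primepow q"
    and "m > 1"
    and "field F" and "finite (carrier F)" and "card (carrier F) = q ^ m"
    and "subfield K F" and "card K = q"
    and "Q = (q ^ m - 1) div (q - 1)"
    and "N dvd q ^ m - 1"
    and "largest_divisor_same_radical (q ^ m - 1) Q dvd N"
  shows "(\<exists>\<xi> \<in> carrier (mult_of F).
            group.ord (mult_of F) \<xi> = N \<and> finite_field_trace F K \<xi> = \<zero>\<^bsub>F\<^esub>)
         \<longleftrightarrow> m \<noteq> 2 \<and> (q, m) \<noteq> (4, 3)"
proof -
  interpret field F by fact
  interpret finite_field_extension F K q m
    by (intro finite_field_extension.intro finite_field_extension_axioms.intro assms)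
  show ?thesis unfolding finite_field_trace_eq
  proof
    assume "\<exists>\<xi>\<in>carrier (mult_of F). group.ord (mult_of F) \<xi> = N \<and> tr \<xi> = \<zero>\<^bsub>F\<^esub>"
    then obtain x where x: "x \<in> carrier F - {\<zero>\<^bsub>F\<^esub>}" "group.ord (mult_of F) x = N" "tr x = \<zero>\<^bsub>F\<^esub>" by auto
    have "m \<noteq> 2"
    proof
      assume m2: "m = 2"
      obtain r where r: "q = Suc r" "r > 0" using q_gt_1 by (cases q) auto
      have "q ^ m - 1 = (q + 1) * (q - 1)" by (simp add: m2 r power2_eq_square algebra_simps)
      then have "Q = q + 1" using assms(8) r by simp
      then show False using no_trace_zero_generator_quadratic[OF m2 x(1,3)] x(2) assms(10) by simp
    qed
    moreover have "(q, m) \<noteq> (4, 3)"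
    proof
      assume "(q, m) = (4, 3)"
      then show False using no_trace_zero_generator_64_over_4[OF _ _ x(1,3)] x(2) assms(8,10) by simp
    qed
    ultimately show "m \<noteq> 2 \<and> (q, m) \<noteq> (4, 3)" by blast
  next
    assume m: "m \<noteq> 2 \<and> (q, m) \<noteq> (4, 3)"
    obtain g where "finite_field_generator F K q m g" by (rule exists_generator)
    then interpret G: finite_field_generator F K q m g .
    have GQ: "G.Q = Q" using assms(8) by (simp add: G.Q_def)
    interpret S: cyclic_difference_set G.Q "(q ^ (m - 2) - 1) div (q - 1)" "q ^ (m - 2)" G.D
      by (rule G.difference_set)
    have "\<exists>i\<in>G.D. coprime i G.Q"
      using m assms(1,2) G.Q_mult G.card_D_mult G.D_multiplier
      by (intro S.exists_coprime_singer[where q = q and m = m]) auto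
    then obtain i where i: "i \<in> G.D" "coprime i G.Q" by blast
    from G.exists_order_of_coprime[OF i assms(9)] assms(10)
    show "\<exists>\<xi>\<in>carrier (mult_of F). group.ord (mult_of F) \<xi> = N \<and> tr \<xi> = \<zero>\<^bsub>F\<^esub>"
      by (simp add: GQ)
  qed
qed

end
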